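(* There is a universal constant $C>0$ with the following property. Let $f=\frac1n\sum_{i=1}^n f_i$ with $f_i=\frac1m\sum_{j=1}^m f_{ij}$, where each $f_{ij}:\mathbb{R}^d\to\mathbb{R}$ is convex and $L$-smooth and each $f_i$ is $\mu$-strongly convex, $\mu>0$; let $\kappa=L/\mu$ and let $x^\star$ be the minimizer of $f$. Run the VR-DIANA algorithm (either variant, described in the context) with an $\omega$-quantization operator, $\alpha=\frac1{\omega+1}$ and $\gamma=\frac{1}{L(1+36(\omega+1)/n)}$. Let $$\psi^0=\|x^0-x^\star\|_2^2+b\gamma^2\sum_{i=1}^n\|h_i^0-\nabla f_i(x^\star)\|_2^2+c\gamma^2\sum_{i=1}^n\sum_{j=1}^m\|\nabla f_{ij}(w_{ij}^0)-\nabla f_{ij}(x^\star)\|_2^2,$$ with $b=\frac{4(\omega+1)}{\alpha n^2}$ and $c=\frac{16(\omega+1)}{n^2}$. Then for every $\varepsilon\in(0,1)$ and every integer $$k\ \ge\ C\left(\kappa+\kappa\frac{\omega}{n}+m+\omega\right)\log\frac1\varepsilon$$ one has $\mathbb{E}[\|x^k-x^\star\|_2^2]\le\varepsilon\,\psi^0$.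
   Context: Differentiable $f$ is $\mu$-strongly convex if $f(y)\ge f(x)+\langle\nabla f(x),y-x\rangle+\frac{\mu}{2}\|x-y\|_2^2$ for all $x,y$; it is $L$-smooth ($L>0$) if $f(y)\le f(x)+\langle\nabla f(x),y-x\rangle+\frac L2\|x-y\|_2^2$ for all $x,y$. An $\omega$-quantization operator ($\omega\ge0$) is a random map $Q:\mathbb{R}^d\to\mathbb{R}^d$ such that for all $x$: $\mathbb{E}_Q[Q(x)]=x$ and $\mathbb{E}_Q[\|Q(x)\|_2^2]\le(\omega+1)\|x\|_2^2$. VR-DIANA algorithm. Input: $\alpha,\gamma>0$, (deterministic) vectors $x^0$, $h_i^0$, $w_{ij}^0\in\mathbb{R}^d$ ($1\le i\le n$, $1\le j\le m$). For $k=0,1,2,\dots$: (Variant 1 only) draw $u^k\in\{0,1\}$ with $P(u^k=1)=\frac1m$. For each worker $i=1,\dots,n$: draw $j_i^k$ uniformly at random from $\{1,\dots,m\}$; set $\mu_i^k=\frac1m\sum_{j=1}^m\nabla f_{ij}(w_{ij}^k)$, $g_i^k=\nabla f_{ij_i^k}(x^k)-\nabla f_{ij_i^k}(w_{ij_i^k}^k)+\mu_i^k$, $\hat\Delta_i^k=Q(g_i^k-h_i^k)$, $h_i^{k+1}=h_i^k+\alpha\hat\Delta_i^k$; and update, for all $j$: in Variant 1 (L-SVRG) $w_{ij}^{k+1}=x^k$ if $u^k=1$ and $w_{ij}^{k+1}=w_{ij}^k$ if $u^k=0$; in Variant 2 (SAGA) $w_{ij}^{k+1}=x^k$ if $j=j_i^k$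 and $w_{ij}^{k+1}=w_{ij}^k$ otherwise. Then set $g^k=\frac1n\sum_{i=1}^n(\hat\Delta_i^k+h_i^k)$ and $x^{k+1}=x^k-\gamma g^k$. All random draws ($u^k$, the $j_i^k$, and the internal randomness of each application of $Q$) are mutually independent and independent of the past. *)

theory Defs
  imports "HOL-Probability.Probability"
begin

text \<open>
  The constant of the theorem must not depend on the dimension \<open>d\<close>, so \<open>d\<close> is a natural number that
  can be quantified inside the existential: \<open>\<real>\<^sup>d\<close> is the set of functions with domain \<open>{..<d}\<close>
  (value \<^const>\<open>undefined\<close> outside it), which is the space of the product \<open>\<sigma>\<close>-algebra
  \<open>PiM {..<d} (\<lambda>_. borel)\<close>. Workers \<open>i\<close>, components \<open>j\<close> and coordinates \<open>l\<close> are numbered from 0.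
\<close>

type_synonym vec = "nat \<Rightarrow> real"

abbreviation Rd :: "nat \<Rightarrow> vec set" where
  "Rd d \<equiv> {..<d} \<rightarrow>\<^sub>E (UNIV :: real set)"

definition Rd_borel :: "nat \<Rightarrow> vec measure" where
  "Rd_borel d = PiM {..<d} (\<lambda>_. borel)"

definition inner_prod :: "nat \<Rightarrow> vec \<Rightarrow> vec \<Rightarrow> real" where
  "inner_prod d u v = (\<Sum>l<d. u l * v l)"

definition norm2 :: "nat \<Rightarrow> vec \<Rightarrow> real" where
  "norm2 d v = L2_set v {..<d}"

text \<open>\<open>g\<close> is the (Frechet) gradient of \<open>F\<close> at \<open>x\<close>. Differences such as \<open>y - x\<close> are pointwise
  differences of functions; only their values on \<open>{..<d}\<close> are used.\<close>

definition has_gradient :: "nat \<Rightarrow> (vec \<Rightarrow> real) \<Rightarrow> vec \<Rightarrow> vec \<Rightarrow> bool" where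
  "has_gradient d F g x \<longleftrightarrow> x \<in> Rd d \<and> g \<in> Rd d \<and>
     (\<forall>e>0. \<exists>\<delta>>0. \<forall>y\<in>Rd d. norm2 d (y - x) < \<delta> \<longrightarrow>
        \<bar>F y - F x - inner_prod d g (y - x)\<bar> \<le> e * norm2 d (y - x))"

definition grad :: "nat \<Rightarrow> (vec \<Rightarrow> real) \<Rightarrow> vec \<Rightarrow> vec" where
  "grad d F x = (THE g. has_gradient d F g x)"

definition differentiable_Rd :: "nat \<Rightarrow> (vec \<Rightarrow> real) \<Rightarrow> bool" where
  "differentiable_Rd d F \<longleftrightarrow> (\<forall>x\<in>Rd d. \<exists>g. has_gradient d F g x)"

definition convex_Rd :: "nat \<Rightarrow> (vec \<Rightarrow> real) \<Rightarrow> bool" where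
  "convex_Rd d F \<longleftrightarrow> (\<forall>x\<in>Rd d. \<forall>y\<in>Rd d. \<forall>t\<in>{0..1}.
     F (\<lambda>l\<in>{..<d}. (1 - t) * x l + t * y l) \<le> (1 - t) * F x + t * F y)"

definition strongly_convex :: "nat \<Rightarrow> real \<Rightarrow> (vec \<Rightarrow> real) \<Rightarrow> bool" where
  "strongly_convex d \<mu> F \<longleftrightarrow> differentiable_Rd d F \<and>
     (\<forall>x\<in>Rd d. \<forall>y\<in>Rd d.
        F y \<ge> F x + inner_prod d (grad d F x) (y - x) + \<mu> / 2 * (norm2 d (x - y))\<^sup>2)"

definition L_smooth :: "nat \<Rightarrow> real \<Rightarrow> (vec \<Rightarrow> real) \<Rightarrow> bool" where
  "L_smooth d L F \<longleftrightarrow> L > 0 \<and> differentiable_Rd d F \<and>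
     (\<forall>x\<in>Rd d. \<forall>y\<in>Rd d.
        F y \<le> F x + inner_prod d (grad d F x) (y - x) + L / 2 * (norm2 d (x - y))\<^sup>2)"

definition average :: "nat \<Rightarrow> (nat \<Rightarrow> vec \<Rightarrow> real) \<Rightarrow> vec \<Rightarrow> real" where
  "average n F x = (\<Sum>i<n. F i x) / real n"

text \<open>A random map on \<open>\<real>\<^sup>d\<close> is given by its kernel: \<open>Q x\<close> is the law of the value at \<open>x\<close>. Nothing else
  matters, since every application of \<open>Q\<close> uses fresh randomness. Integrability is demanded
  explicitly because the Bochner integral of a non-integrable function is 0.\<close>

definition quantization_operator :: "nat \<Rightarrow> real \<Rightarrow> (vec \<Rightarrow> vec measure) \<Rightarrow> bool" where
  "quantization_operator d \<omega> Q \<longleftrightarrow> \<omega> \<ge> 0 \<and>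
     Q \<in> Rd_borel d \<rightarrow>\<^sub>M prob_algebra (Rd_borel d) \<and>
     (\<forall>x\<in>Rd d.
        (\<forall>l<d. integrable (Q x) (\<lambda>y. y l) \<and> (\<integral>y. y l \<partial>Q x) = x l) \<and>
        integrable (Q x) (\<lambda>y. (norm2 d y)\<^sup>2) \<and>
        (\<integral>y. (norm2 d y)\<^sup>2 \<partial>Q x) \<le> (\<omega> + 1) * (norm2 d x)\<^sup>2)"

datatype variant = L_SVRG | SAGA

text \<open>A state \<open>(x, h, w)\<close> consists of the iterate, the vectors \<open>h i\<close> for \<open>i < n\<close> and the vectors
  \<open>w i j\<close> for \<open>i < n\<close> and \<open>j < m\<close>.\<close>

type_synonym state = "vec \<times> (nat \<Rightarrow> vec) \<times> (nat \<Rightarrow> nat \<Rightarrow> vec)"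

definition state_space :: "nat \<Rightarrow> nat \<Rightarrow> nat \<Rightarrow> state measure" where
  "state_space d n m =
     Rd_borel d \<Otimes>\<^sub>M PiM {..<n} (\<lambda>_. Rd_borel d) \<Otimes>\<^sub>M
       PiM {..<n} (\<lambda>_. PiM {..<m} (\<lambda>_. Rd_borel d))"

text \<open>The estimator \<open>g\<^sub>i\<close> of one worker with components \<open>fi\<close> and reference points \<open>wi\<close>, for the
  sampled index \<open>j\<close>.\<close>

definition grad_estimator ::
    "nat \<Rightarrow> nat \<Rightarrow> (nat \<Rightarrow> vec \<Rightarrow> real) \<Rightarrow> vec \<Rightarrow> (nat \<Rightarrow> vec) \<Rightarrow> nat \<Rightarrow> vec" where
  "grad_estimator d m fi x wi j =
     (\<lambda>l\<in>{..<d}. grad d (fi j) x l - grad d (fi j) (wi j) l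
        + (\<Sum>j'<m. grad d (fi j') (wi j') l) / real m)"

text \<open>The new state for given outcomes \<open>u\<close>, \<open>jj\<close>, \<open>\<Delta>\<close> of the random draws.\<close>

definition update ::
    "variant \<Rightarrow> nat \<Rightarrow> nat \<Rightarrow> nat \<Rightarrow> real \<Rightarrow> real \<Rightarrow> bool \<Rightarrow> (nat \<Rightarrow> nat) \<Rightarrow> (nat \<Rightarrow> vec) \<Rightarrow>
       state \<Rightarrow> state" where
  "update v d n m \<alpha> \<gamma> u jj \<Delta> = (\<lambda>(x, h, w).
     (\<lambda>l\<in>{..<d}. x l - \<gamma> * ((\<Sum>i<n. \<Delta> i l + h i l) / real n),
      \<lambda>i\<in>{..<n}. \<lambda>l\<in>{..<d}. h i l + \<alpha> * \<Delta> i l,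
      \<lambda>i\<in>{..<n}. \<lambda>j\<in>{..<m}.
        (case v of
           L_SVRG \<Rightarrow> (if u then x else w i j)
         | SAGA \<Rightarrow> (if j = jj i then x else w i j))))"

text \<open>One iteration as a Markov kernel in the Giry monad. The draws of one iteration are mutually
  independent because their laws are combined by product measures and \<open>bind\<close>, and each iteration
  starts from the current state with fresh randomness. The coin \<open>u\<close> is ignored by \<^const>\<open>SAGA\<close>.\<close>

definition vr_diana_step ::
    "variant \<Rightarrow> nat \<Rightarrow> nat \<Rightarrow> nat \<Rightarrow> (nat \<Rightarrow> nat \<Rightarrow> vec \<Rightarrow> real) \<Rightarrow> (vec \<Rightarrow> vec measure) \<Rightarrow>
       real \<Rightarrow> real \<Rightarrow> state \<Rightarrow> state measure" where
  "vr_diana_step v d n m f Q \<alpha> \<gamma> = (\<lambda>(x, h, w).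
     do {
       u \<leftarrow> measure_pmf (bernoulli_pmf (1 / real m));
       jj \<leftarrow> measure_pmf (Pi_pmf {..<n} 0 (\<lambda>_. pmf_of_set {..<m}));
       \<Delta> \<leftarrow> PiM {..<n} (\<lambda>i.
             Q (\<lambda>l\<in>{..<d}. grad_estimator d m (f i) x (w i) (jj i) l - h i l));
       return (state_space d n m) (update v d n m \<alpha> \<gamma> u jj \<Delta> (x, h, w))
     })"

text \<open>The law of the state \<open>(x\<^sup>k, h\<^sup>k, w\<^sup>k)\<close>.\<close>

primrec vr_diana ::
    "variant \<Rightarrow> nat \<Rightarrow> nat \<Rightarrow> nat \<Rightarrow> (nat \<Rightarrow> nat \<Rightarrow> vec \<Rightarrow> real) \<Rightarrow> (vec \<Rightarrow> vec measure) \<Rightarrow>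
       real \<Rightarrow> real \<Rightarrow> state \<Rightarrow> nat \<Rightarrow> state measure" where
  "vr_diana v d n m f Q \<alpha> \<gamma> s0 0 = return (state_space d n m) s0"
| "vr_diana v d n m f Q \<alpha> \<gamma> s0 (Suc k) =
     do { s \<leftarrow> vr_diana v d n m f Q \<alpha> \<gamma> s0 k; vr_diana_step v d n m f Q \<alpha> \<gamma> s }"

definition lyapunov ::
    "nat \<Rightarrow> nat \<Rightarrow> nat \<Rightarrow> (nat \<Rightarrow> nat \<Rightarrow> vec \<Rightarrow> real) \<Rightarrow> real \<Rightarrow> real \<Rightarrow> real \<Rightarrow> vec \<Rightarrow> state \<Rightarrow> real" where
  "lyapunov d n m f b c \<gamma> xs = (\<lambda>(x, h, w).
     (norm2 d (x - xs))\<^sup>2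
     + b * \<gamma>\<^sup>2 * (\<Sum>i<n. (norm2 d (h i - grad d (average m (f i)) xs))\<^sup>2)
     + c * \<gamma>\<^sup>2 * (\<Sum>i<n. \<Sum>j<m. (norm2 d (grad d (f i j) (w i j) - grad d (f i j) xs))\<^sup>2))"

end

theory Submission
  imports Defs
begin

text \<open>
  One Lyapunov function does all the work: \<^const>\<open>lyapunov\<close> adds to the squared distance of the
  iterate from the minimizer the errors of the shift vectors \<open>h\<close> and of the reference points \<open>w\<close>.
  One iteration of VR-DIANA multiplies its conditional expectation by at most \<open>1 - \<rho>\<close>, where \<open>\<rho>\<close> may
  be any number not exceeding \<open>\<gamma> * \<mu>\<close>, \<open>\<alpha> / 2\<close> and \<open>3 / (8 * m)\<close>. With
  \<open>D = \<kappa> + \<kappa> * \<omega> / n + m + \<omega>\<close> the choice \<open>\<rho> = 1 / (37 * D)\<close> is admissible, so \<open>C = 37\<close> works: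
  \<open>(1 - \<rho>)^k \<le> exp (- \<rho> * k) \<le> \<epsilon>\<close> as soon as \<open>k \<ge> 37 * D * ln (1 / \<epsilon>)\<close>.

  The contraction rests on independence. Write \<open>A\<close> for the sum over the workers of the mean squared
  differences between component gradients at \<open>x\<close> and at the minimizer, \<open>W\<close> for the same quantity
  at the reference points, and \<open>H\<close> for the error of the shifts. The messages of different workers
  are independent given the sampled indices, and so are the indices, hence the variances of the
  workers add up and averaging divides them by \<open>n\<^sup>2\<close> (\<open>second_moment_sum_uncorrelated\<close>). The sampling
  variance of one estimator is controlled by \<open>2 * A + 2 * W\<close>, and quantization adds at most
  \<open>\<omega>\<close> times the squared norm of the quantized vector. The following happens in expectation.

  \<^item> The squared distance becomes that of a full gradient step, plus a multiple of
    \<open>\<gamma>\<^sup>2 / n\<^sup>2\<close> times \<open>A\<close>, \<open>W\<close> and \<open>H\<close>.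
  \<^item> The error of the shifts becomes a convex combination of \<open>H\<close> and of the error of the estimators;
    this is where \<open>\<alpha> = 1 / (\<omega> + 1)\<close> is used.
  \<^item> In both variants every reference point is replaced by \<open>x\<close> with probability \<open>1 / m\<close>, which
    replaces the fraction \<open>1 / m\<close> of \<open>W\<close> by the fraction \<open>1 / m\<close> of \<open>A\<close>.

  The weights \<open>b\<close> and \<open>c\<close> are such that the decrease of \<open>H\<close> and \<open>W\<close> pays for the noise that they
  cause. What remains is a multiple of \<open>\<gamma>\<^sup>2 * A\<close>, and \<open>A \<le> 2 * L * n * (F x - F x\<^sup>*)\<close> for the
  objective \<open>F\<close> by convexity and smoothness (\<open>convex_smooth_lower_bound\<close>). The full gradient step
  gains \<open>2 * \<gamma> * (F x - F x\<^sup>*)\<close> on top of the factor \<open>1 - \<gamma> * \<mu>\<close>; the step size is chosen so that this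
  gain covers the remaining noise.

  The measure-theoretic part shows that an iteration is a measurable Markov kernel, so that the
  one-step bound can be integrated along the chain. Gradients of convex smooth functions are
  Lipschitz continuous, hence Borel measurable. The Lyapunov function is nonnegative, so the
  chain is handled with nonnegative integrals, and integrability of the squared distance comes out
  at the end.
\<close>

section \<open>Inner product and norm in coordinates\<close>

lemma norm2_sq: "(norm2 d v)\<^sup>2 = (\<Sum>l<d. (v l)\<^sup>2)"
  by (simp add: norm2_def L2_set_def sum_nonneg)

lemma norm2_nonneg: "0 \<le> norm2 d v"
  by (simp add: norm2_def)

lemma norm2_sq_inner: "(norm2 d v)\<^sup>2 = inner_prod d v v"
  by (simp add: norm2_sq inner_prod_def) (simp add: power2_eq_square)

lemma inner_prod_linear:
  "inner_prod d g (u - v) = inner_prod d g u - inner_prod d g v"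
  "inner_prod d (u - v) g = inner_prod d u g - inner_prod d v g"
  "inner_prod d g (\<lambda>l. t * u l) = t * inner_prod d g u"
  "inner_prod d (\<lambda>l. t * u l) g = t * inner_prod d u g"
  by (simp_all add: inner_prod_def algebra_simps sum_subtractf sum_distrib_left)

lemma norm2_scale: "norm2 d (\<lambda>l. t * u l) = \<bar>t\<bar> * norm2 d u"
proof (rule power2_eq_imp_eq)
  show "(norm2 d (\<lambda>l. t * u l))\<^sup>2 = (\<bar>t\<bar> * norm2 d u)\<^sup>2"
    by (simp add: norm2_sq power_mult_distrib sum_distrib_left)
qed (auto simp: norm2_nonneg)

lemma norm2_minus_commute: "norm2 d (u - v) = norm2 d (v - u)"
  using norm2_scale[of d "-1" "u - v"] by (simp add: fun_diff_def)

lemma inner_prod_le: "inner_prod d u v \<le> norm2 d u * norm2 d v"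
proof -
  have "inner_prod d u v \<le> (\<Sum>l<d. \<bar>u l\<bar> * \<bar>v l\<bar>)"
    unfolding inner_prod_def by (rule sum_mono) (metis abs_ge_self abs_mult)
  also have "\<dots> \<le> norm2 d u * norm2 d v"
    unfolding norm2_def by (rule L2_set_mult_ineq)
  finally show ?thesis .
qed

lemma inner_prod_cong:
  "(\<And>l. l < d \<Longrightarrow> u l = u' l) \<Longrightarrow> (\<And>l. l < d \<Longrightarrow> v l = v' l) \<Longrightarrow> inner_prod d u v = inner_prod d u' v'"
  by (simp add: inner_prod_def)

lemma norm2_cong: "(\<And>l. l < d \<Longrightarrow> u l = u' l) \<Longrightarrow> norm2 d u = norm2 d u'"
  by (simp add: norm2_def L2_set_def)


section \<open>Gradients of convex smooth functions\<close>

definition step_along :: "nat \<Rightarrow> vec \<Rightarrow> real \<Rightarrow> vec \<Rightarrow> vec" where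
  "step_along d x t v = (\<lambda>l\<in>{..<d}. x l + t * v l)"

lemma step_along_Rd [simp]: "step_along d x t v \<in> Rd d"
  by (auto simp: step_along_def)

lemma norm2_step_along [simp]: "norm2 d (step_along d x t v - x) = \<bar>t\<bar> * norm2 d v"
  unfolding norm2_scale[symmetric] by (rule norm2_cong) (simp add: step_along_def)

lemma inner_step_along [simp]: "inner_prod d g (step_along d x t v - x) = t * inner_prod d g v"
  unfolding inner_prod_linear(3)[symmetric] by (rule inner_prod_cong) (simp_all add: step_along_def)

lemma has_gradientD:
  assumes "has_gradient d F g x" and "e > 0"
  shows "\<exists>\<delta>>0. \<forall>y. y \<in> Rd d \<and> norm2 d (y - x) < \<delta> \<longrightarrow>
      \<bar>F y - F x - inner_prod d g (y - x)\<bar> \<le> e * norm2 d (y - x)"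
  using assms(1)[unfolded has_gradient_def, THEN conjunct2, THEN conjunct2] assms(2)
  unfolding Ball_def by (metis (no_types, lifting))

text \<open>
  Along a ray \<open>x + t * v\<close>, with \<open>t\<close> tending to 0 from the right, the condition in
  \<^const>\<open>has_gradient\<close> becomes an eventuality, and several such conditions can be combined.
\<close>

lemma has_gradient_ray:
  assumes "has_gradient d F g x" and "e > 0"
  shows "eventually (\<lambda>t. \<bar>F (step_along d x t v) - F x - t * inner_prod d g v\<bar> \<le> e * (t * norm2 d v))
    (at_right 0)"
proof -
  obtain \<delta> where \<delta>: "\<delta> > 0" "\<And>y. y \<in> Rd d \<and> norm2 d (y - x) < \<delta> \<Longrightarrow>
      \<bar>F y - F x - inner_prod d g (y - x)\<bar> \<le> e * norm2 d (y - x)"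
    using has_gradientD[OF assms] by metis
  have "((\<lambda>t. t * norm2 d v) \<longlongrightarrow> 0 * norm2 d v) (at_right 0)"
    by (intro tendsto_intros)
  then have "eventually (\<lambda>t. t * norm2 d v < \<delta>) (at_right 0)"
    using \<delta>(1) by (intro order_tendstoD(2)) auto
  moreover have "eventually (\<lambda>t. t > (0::real)) (at_right 0)"
    by (rule eventually_at_right_less)
  ultimately show ?thesis
  proof eventually_elim
    case (elim t)
    then show ?case using \<delta>(2)[of "step_along d x t v"] by simp
  qed
qed

text \<open>
  Uniqueness gives access to \<^const>\<open>grad\<close>, which is a definite description. Two gradients are
  compared along the ray in the direction of their difference.
\<close>

lemma has_gradient_unique:
  assumes "has_gradient d F g x" "has_gradient d F g' x"
  shows "g = g'"
proof -
  have Rd: "g \<in> Rd d" "g' \<in> Rd d" using assms by (auto simp: has_gradient_def)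
  define v where "v = g - g'"
  have e: "(norm2 d v)\<^sup>2 \<le> 0 + e" if "e > 0" for e
  proof -
    define e' where "e' = e / (2 * (norm2 d v + 1))"
    have e': "e' > 0" using that norm2_nonneg[of d v] by (simp add: e'_def)
    have "eventually (\<lambda>t. t > (0::real)) (at_right 0)" by (rule eventually_at_right_less)
    with has_gradient_ray[OF assms(1) e', of v] has_gradient_ray[OF assms(2) e', of v]
    have "eventually (\<lambda>t. t * inner_prod d v v \<le> t * (2 * e' * norm2 d v)) (at_right 0)"
    proof eventually_elim
      case (elim t)
      then have "t * inner_prod d g v - t * inner_prod d g' v \<le> t * (2 * e' * norm2 d v)"
        by (simp add: algebra_simps)
      then show ?case by (simp add: v_def inner_prod_linear algebra_simps)
    qed
    moreover have "eventually (\<lambda>t. t > (0::real)) (at_right 0)" by (rule eventually_at_right_less)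
    ultimately have "eventually (\<lambda>t::real. inner_prod d v v \<le> 2 * e' * norm2 d v) (at_right 0)"
      by eventually_elim simp
    then have "inner_prod d v v \<le> 2 * e' * norm2 d v"
      by simp
    also have "\<dots> \<le> 2 * e' * (norm2 d v + 1)" using e' by simp
    also have "\<dots> = e" using norm2_nonneg[of d v] by (simp add: e'_def divide_simps)
    finally show ?thesis by (simp add: norm2_sq_inner)
  qed
  then have "(norm2 d v)\<^sup>2 \<le> 0" by (rule field_le_epsilon)
  then have "norm2 d v = 0" by simp
  then have "\<forall>l<d. g l = g' l" by (simp add: norm2_def L2_set_eq_0_iff v_def)
  then show ?thesis by (intro PiE_ext[OF Rd]) auto
qed

lemma has_gradient_grad:
  assumes "differentiable_Rd d F" "x \<in> Rd d"
  shows "has_gradient d F (grad d F x) x"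
  using assms unfolding differentiable_Rd_def grad_def
  by (metis has_gradient_unique theI)

lemma grad_eqI: "has_gradient d F g x \<Longrightarrow> grad d F x = g"
  unfolding grad_def by (blast intro: has_gradient_unique)

text \<open>
  The gradients of a worker's function \<open>average m (f i)\<close> must be expressed by those of the
  components, because the estimators are built from the latter.
\<close>

lemma has_gradient_average:
  assumes "m \<ge> 1" and "x \<in> Rd d" and G: "\<And>j. j < m \<Longrightarrow> has_gradient d (F j) (G j) x"
  shows "has_gradient d (average m F) (\<lambda>l\<in>{..<d}. (\<Sum>j<m. G j l) / real m) x"
  unfolding has_gradient_def
proof (intro conjI allI impI)
  fix e :: real assume "e > 0"
  then have "\<exists>\<delta>>0. \<forall>y. y \<in> Rd d \<and> norm2 d (y - x) < \<delta> \<longrightarrow>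
      \<bar>F j y - F j x - inner_prod d (G j) (y - x)\<bar> \<le> e * norm2 d (y - x)" if "j < m" for j
    by (rule has_gradientD[OF G[OF that]])
  then obtain \<delta> where \<delta>: "\<And>j. j < m \<Longrightarrow> \<delta> j > 0"
    "\<And>j y. j < m \<Longrightarrow> y \<in> Rd d \<and> norm2 d (y - x) < \<delta> j \<Longrightarrow>
      \<bar>F j y - F j x - inner_prod d (G j) (y - x)\<bar> \<le> e * norm2 d (y - x)"
    by metis
  let ?D = "Min (\<delta> ` {..<m})"
  have ne: "\<delta> ` {..<m} \<noteq> {}" using assms(1) by (auto simp: lessThan_empty_iff)
  show "\<exists>\<delta>>0. \<forall>y\<in>Rd d. norm2 d (y - x) < \<delta> \<longrightarrow>
    \<bar>average m F y - average m F x
      - inner_prod d (\<lambda>l\<in>{..<d}. (\<Sum>j<m. G j l) / real m) (y - x)\<bar> \<le> e * norm2 d (y - x)"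
  proof (intro exI[of _ ?D] conjI ballI impI)
    show "?D > 0" using ne \<delta>(1) by (subst Min_gr_iff) auto
    fix y assume y: "y \<in> Rd d" "norm2 d (y - x) < ?D"
    have "inner_prod d (\<lambda>l\<in>{..<d}. (\<Sum>j<m. G j l) / real m) (y - x)
        = (\<Sum>j<m. inner_prod d (G j) (y - x)) / real m"
      unfolding inner_prod_def
      by (subst sum.swap) (simp add: sum_divide_distrib sum_distrib_right)
    then have "average m F y - average m F x
        - inner_prod d (\<lambda>l\<in>{..<d}. (\<Sum>j<m. G j l) / real m) (y - x)
        = (\<Sum>j<m. F j y - F j x - inner_prod d (G j) (y - x)) / real m"
      by (simp add: average_def sum_subtractf diff_divide_distrib)
    moreover have "\<bar>\<Sum>j<m. F j y - F j x - inner_prod d (G j) (y - x)\<bar> \<le> (\<Sum>j<m. e * norm2 d (y - x))"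
      using y ne by (intro order_trans[OF sum_abs] sum_mono \<delta>(2)) auto
    ultimately show "\<bar>average m F y - average m F x
        - inner_prod d (\<lambda>l\<in>{..<d}. (\<Sum>j<m. G j l) / real m) (y - x)\<bar> \<le> e * norm2 d (y - x)"
      using assms(1) by (simp only: abs_divide) (simp add: divide_simps mult.commute)
  qed
qed (use assms in auto)

lemma grad_average:
  assumes "m \<ge> 1" "x \<in> Rd d" "\<And>j. j < m \<Longrightarrow> differentiable_Rd d (F j)"
  shows "grad d (average m F) x = (\<lambda>l\<in>{..<d}. (\<Sum>j<m. grad d (F j) x l) / real m)"
  using assms by (intro grad_eqI has_gradient_average has_gradient_grad)

text \<open>
  Convexity bounds \<open>F (x + t * (y - x)) - F x\<close> above by \<open>t * (F y - F x)\<close>; dividing by \<open>t\<close> and letting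
  \<open>t\<close> tend to 0 replaces the left-hand side by the directional derivative.
\<close>

lemma convex_first_order:
  assumes "convex_Rd d F" "differentiable_Rd d F" "x \<in> Rd d" "y \<in> Rd d"
  shows "F y \<ge> F x + inner_prod d (grad d F x) (y - x)"
proof -
  let ?g = "grad d F x" and ?v = "y - x"
  have "inner_prod d ?g ?v \<le> (F y - F x) + e" if "e > 0" for e
  proof -
    define e' where "e' = e / (norm2 d ?v + 1)"
    have e': "e' > 0" using that norm2_nonneg[of d ?v] by (simp add: e'_def)
    have "eventually (\<lambda>t. t > (0::real)) (at_right 0)" by (rule eventually_at_right_less)
    moreover have "eventually (\<lambda>t. t < (1::real)) (at_right 0)"
      by (rule order_tendstoD(2)[OF tendsto_ident_at]) simp
    ultimately
    have "eventually (\<lambda>t. inner_prod d ?g ?v \<le> F y - F x + e' * norm2 d ?v) (at_right (0::real))"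
      using has_gradient_ray[OF has_gradient_grad[OF assms(2,3)] e', of ?v]
    proof eventually_elim
      case (elim t)
      have "step_along d x t ?v = (\<lambda>l\<in>{..<d}. (1 - t) * x l + t * y l)"
        by (auto simp: step_along_def algebra_simps)
      then have "F (step_along d x t ?v) \<le> (1 - t) * F x + t * F y"
        using assms elim unfolding convex_Rd_def by auto
      then have "t * inner_prod d ?g ?v \<le> t * (F y - F x + e' * norm2 d ?v)"
        using elim by (simp add: algebra_simps abs_le_iff)
      then show ?case using elim by simp
    qed
    then have "inner_prod d ?g ?v \<le> F y - F x + e' * norm2 d ?v" by simp
    also have "\<dots> \<le> F y - F x + e' * (norm2 d ?v + 1)" using e' by simp
    also have "\<dots> = F y - F x + e" using norm2_nonneg[of d ?v] by (simp add: e'_def divide_simps)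
    finally show ?thesis .
  qed
  then have "inner_prod d ?g ?v \<le> F y - F x" by (rule field_le_epsilon)
  then show ?thesis by simp
qed

text \<open>
  A gradient step with step size \<open>1 / L\<close> from \<open>y\<close> on the function \<open>F - \<langle>grad F x, _\<rangle>\<close> decreases it by
  \<open>\<bar>grad F y - grad F x\<bar>\<^sup>2 / (2 * L)\<close> at least, by smoothness; but \<open>x\<close> minimizes this function, by
  convexity. This estimate converts differences of gradients into differences of function values.
\<close>

lemma convex_smooth_lower_bound:
  assumes "convex_Rd d F" "L_smooth d L F" "x \<in> Rd d" "y \<in> Rd d"
  shows "F y \<ge> F x + inner_prod d (grad d F x) (y - x)
            + (norm2 d (grad d F y - grad d F x))\<^sup>2 / (2 * L)"
proof -
  have L: "L > 0" "differentiable_Rd d F" using assms(2) by (auto simp: L_smooth_def)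
  let ?v = "grad d F y - grad d F x"
  \<comment> \<open>the gradient step from y on the function with its linear part at x removed\<close>
  define z where "z = step_along d y (- (1 / L)) ?v"
  have z: "z \<in> Rd d" by (simp add: z_def)
  have 1: "F z \<ge> F x + inner_prod d (grad d F x) (z - x)"
    using assms L z by (intro convex_first_order)
  have "F z \<le> F y + inner_prod d (grad d F y) (z - y) + L / 2 * (norm2 d (y - z))\<^sup>2"
    using assms z by (auto simp: L_smooth_def)
  moreover have "inner_prod d (grad d F x) (z - x)
      = inner_prod d (grad d F x) (z - y) + inner_prod d (grad d F x) (y - x)"
    by (simp add: inner_prod_linear)
  moreover have "inner_prod d (grad d F y) (z - y) - inner_prod d (grad d F x) (z - y)
      = - ((norm2 d ?v)\<^sup>2 / L)"
    unfolding inner_prod_linear(2)[symmetric] by (simp add: z_def norm2_sq_inner)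
  moreover have "L / 2 * (norm2 d (y - z))\<^sup>2 = (norm2 d ?v)\<^sup>2 / (2 * L)"
    using L by (simp add: norm2_minus_commute[of d y] z_def power2_eq_square field_simps)
  moreover have "(norm2 d ?v)\<^sup>2 / L = 2 * ((norm2 d ?v)\<^sup>2 / (2 * L))"
    using L by simp
  ultimately show ?thesis using 1 by linarith
qed

text \<open>
  Adding the lower bound for \<open>(x, y)\<close> to the one for \<open>(y, x)\<close> shows that the gradient is cocoercive;
  the Cauchy-Schwarz inequality turns this into the Lipschitz bound.
\<close>

lemma grad_lipschitz:
  assumes "convex_Rd d F" "L_smooth d L F" "x \<in> Rd d" "y \<in> Rd d"
  shows "norm2 d (grad d F y - grad d F x) \<le> L * norm2 d (y - x)"
proof -
  have L: "L > 0" using assms(2) by (auto simp: L_smooth_def)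
  let ?v = "grad d F y - grad d F x"
  have "(norm2 d ?v)\<^sup>2 / (2 * L) + (norm2 d ?v)\<^sup>2 / (2 * L) \<le> inner_prod d ?v (y - x)"
    using convex_smooth_lower_bound[OF assms] convex_smooth_lower_bound[OF assms(1,2,4,3)]
    by (simp add: inner_prod_linear norm2_minus_commute[of d "grad d F x"])
  also have "\<dots> \<le> norm2 d ?v * norm2 d (y - x)" by (rule inner_prod_le)
  finally have "norm2 d ?v * norm2 d ?v \<le> norm2 d ?v * (L * norm2 d (y - x))"
    using L by (simp add: field_simps power2_eq_square)
  then show ?thesis
    using norm2_nonneg[of d ?v] norm2_nonneg[of d "y - x"] L
    by (cases "norm2 d ?v = 0") (auto simp: mult_le_cancel_left)
qed

lemma space_Rd_borel [simp]: "space (Rd_borel d) = Rd d"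
  by (simp add: Rd_borel_def space_PiM)

lemma measurable_Rd_component [measurable]: "l < d \<Longrightarrow> (\<lambda>x. x l) \<in> borel_measurable (Rd_borel d)"
  unfolding Rd_borel_def by simp

lemma measurable_Rd_restrict:
  "(\<And>l. l < d \<Longrightarrow> (\<lambda>s. g s l) \<in> borel_measurable M) \<Longrightarrow>
     (\<lambda>s. \<lambda>l\<in>{..<d}. g s l) \<in> M \<rightarrow>\<^sub>M Rd_borel d"
  unfolding Rd_borel_def by (intro measurable_restrict) auto

text \<open>
  The gradient is Lipschitz continuous. To pass from continuity to measurability, its components are
  extended, by restriction of the argument, to all functions on the natural numbers: there the product
  \<open>\<sigma>\<close>-algebra is the Borel algebra of the product topology. Padding with zeros maps \<^const>\<open>Rd_borel\<close>
  measurably into this space.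
\<close>

lemma measurable_grad:
  assumes "convex_Rd d F" "L_smooth d L F" "l < d"
  shows "(\<lambda>x. grad d F x l) \<in> borel_measurable (Rd_borel d)"
proof -
  \<comment> \<open>the extension depends only on the coordinates below d, so it inherits the Lipschitz bound\<close>
  define G :: "vec \<Rightarrow> real" where "G x = grad d F (restrict x {..<d}) l" for x
  have Lip: "\<bar>G y - G x\<bar> \<le> L * norm2 d (y - x)" for x y
  proof -
    have "\<bar>G y - G x\<bar> \<le> norm2 d (grad d F (restrict y {..<d}) - grad d F (restrict x {..<d}))"
      unfolding norm2_def
      using member_le_L2_set[of "{..<d}" l "\<lambda>l. \<bar>(grad d F (restrict y {..<d}) - grad d F (restrict x {..<d})) l\<bar>"]
        assms(3) by (simp add: G_def L2_set_def)
    also have "\<dots> \<le> L * norm2 d (restrict y {..<d} - restrict x {..<d})"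
      using assms by (intro grad_lipschitz) auto
    also have "norm2 d (restrict y {..<d} - restrict x {..<d}) = norm2 d (y - x)"
      by (rule norm2_cong) simp
    finally show ?thesis .
  qed
  have "continuous_on UNIV G"
    unfolding continuous_on_def
  proof
    fix x :: vec
    have c: "((\<lambda>y::vec. y i) \<longlongrightarrow> x i) (at x)" for i
      using continuous_on_product_coordinates[of i] by (auto simp: continuous_on_def)
    have "((\<lambda>y. L * norm2 d (y - x)) \<longlongrightarrow> L * sqrt (\<Sum>l<d. (x l - x l)\<^sup>2)) (at x)"
      unfolding norm2_def L2_set_def fun_diff_def by (intro tendsto_intros c)
    then have "((\<lambda>y. L * norm2 d (y - x)) \<longlongrightarrow> 0) (at x)" by simp
    then have "((\<lambda>y. G y - G x) \<longlongrightarrow> 0) (at x)"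
      by (rule Lim_null_comparison[rotated]) (intro always_eventually allI, simp only: real_norm_def Lip)
    then show "(G \<longlongrightarrow> G x) (at x within UNIV)" by (rule LIM_zero_cancel)
  qed
  then have "G \<in> borel_measurable borel" by (rule borel_measurable_continuous_onI)
  moreover have "(\<lambda>x i. if i < d then x i else 0) \<in> Rd_borel d \<rightarrow>\<^sub>M (borel :: vec measure)"
  proof (rule measurable_coordinatewise_then_product)
    show "(\<lambda>x. if i < d then x i else 0) \<in> borel_measurable (Rd_borel d)" for i
      by (cases "i < d") simp_all
  qed
  ultimately have "(\<lambda>x. G (\<lambda>i. if i < d then x i else 0)) \<in> borel_measurable (Rd_borel d)"
    by (rule measurable_compose[rotated])
  also have "?this \<longleftrightarrow> ?thesis"
  proof (rule measurable_cong)
    fix x assume "x \<in> space (Rd_borel d)"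
    then have "(\<lambda>i\<in>{..<d}. if i < d then x i else 0) = x"
      by (intro PiE_ext[of _ "{..<d}" "\<lambda>_. UNIV"]) auto
    then show "G (\<lambda>i. if i < d then x i else 0) = grad d F x l" by (simp add: G_def)
  qed
  finally show ?thesis .
qed

section \<open>An iteration as a measurable Markov kernel\<close>

text \<open>
  Measurability of a kernel can be checked on the boxes, which generate the product \<open>\<sigma>\<close>-algebra; the
  measure of a box is a finite product of measurable functions.
\<close>

lemma measurable_PiM_kernel:
  assumes "finite I" and K: "\<And>i. i \<in> I \<Longrightarrow> K i \<in> S \<rightarrow>\<^sub>M prob_algebra (M i)"
  shows "(\<lambda>s. PiM I (\<lambda>i. K i s)) \<in> S \<rightarrow>\<^sub>M prob_algebra (PiM I M)"
proof (rule measurable_prob_algebra_generated[OF sets_PiM Int_stable_prod_algebra prod_algebra_sets_into_space])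
  have K': "prob_space (K i s)" "sets (K i s) = sets (M i)" if "i \<in> I" "s \<in> space S" for i s
    using measurable_space[OF K[OF that(1)] that(2)] by (auto simp: space_prob_algebra)
  fix s assume s: "s \<in> space S"
  show "prob_space (PiM I (\<lambda>i. K i s))" using K' s by (intro prob_space_PiM) auto
  show "sets (PiM I (\<lambda>i. K i s)) = sets (PiM I M)" using K' s by (intro sets_PiM_cong) auto
next
  have K': "prob_space (K i s)" "sets (K i s) = sets (M i)" if "i \<in> I" "s \<in> space S" for i s
    using measurable_space[OF K[OF that(1)] that(2)] by (auto simp: space_prob_algebra)
  fix A assume "A \<in> prod_algebra I M"
  then obtain E where E: "A = Pi\<^sub>E I E" "\<And>i. i \<in> I \<Longrightarrow> E i \<in> sets (M i)"
    unfolding prod_algebra_eq_finite[OF assms(1)] by auto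
  have "emeasure (PiM I (\<lambda>i. K i s)) A = (\<Prod>i\<in>I. emeasure (K i s) (E i))" if s: "s \<in> space S" for s
  proof -
    \<comment> \<open>product measures need a probability measure at every index, also outside I\<close>
    define N where "N i = (if i \<in> I then K i s else return (count_space UNIV) undefined)" for i
    interpret product_prob_space N I
      by (intro product_prob_spaceI) (auto simp: N_def K' s prob_space_return)
    have "PiM I (\<lambda>i. K i s) = PiM I N" by (intro PiM_cong) (auto simp: N_def)
    moreover have "emeasure (PiM I N) A = (\<Prod>i\<in>I. emeasure (N i) (E i))"
      unfolding E(1) using E(2) assms(1) K' s by (intro emeasure_PiM) (auto simp: N_def)
    ultimately show ?thesis by (simp add: N_def)
  qed
  moreover have "(\<lambda>s. \<Prod>i\<in>I. emeasure (K i s) (E i)) \<in> borel_measurable S"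
  proof (rule borel_measurable_prod_ennreal)
    fix i assume i: "i \<in> I"
    show "(\<lambda>s. emeasure (K i s) (E i)) \<in> borel_measurable S"
      by (rule measurable_emeasure_kernel[OF measurable_prob_algebraD[OF K[OF i]] E(2)[OF i]])
  qed
  ultimately show "(\<lambda>s. emeasure (PiM I (\<lambda>i. K i s)) A) \<in> borel_measurable S"
    by (subst measurable_cong) auto
qed

lemma measure_pmf_in_prob_algebra: "measure_pmf p \<in> space (prob_algebra (count_space UNIV))"
  by (simp add: space_prob_algebra prob_space_measure_pmf)

lemma bind_measure_pmf_in_prob_algebra:
  "(\<And>z. K z \<in> space (prob_algebra T)) \<Longrightarrow> measure_pmf p \<bind> K \<in> space (prob_algebra T)"
  using prob_space_bind'[OF measure_pmf_in_prob_algebra[of p], of K T]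
    sets_bind'[OF measure_pmf_in_prob_algebra[of p], of K T]
  by (simp add: space_prob_algebra)

text \<open>
  The index vectors form an uncountable discrete space, on which measurability in the state for each
  index vector does not give joint measurability. But only finitely many index vectors have positive probability, and
  for a finite support the bind is a finite sum of kernels. Measurability in the state is required
  on the support only: the gradients of components with index beyond \<open>m\<close> are arbitrary functions.
\<close>

lemma measurable_bind_finite_pmf:
  assumes fin: "finite (set_pmf p)" and K: "\<And>z. z \<in> set_pmf p \<Longrightarrow> K z \<in> S \<rightarrow>\<^sub>M prob_algebra T"
    and KT: "\<And>z s. s \<in> space S \<Longrightarrow> K z s \<in> space (prob_algebra T)"
  shows "(\<lambda>s. measure_pmf p \<bind> (\<lambda>z. K z s)) \<in> S \<rightarrow>\<^sub>M prob_algebra T"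
proof -
  have bind: "measure_pmf p \<bind> (\<lambda>z. K z s) \<in> space (prob_algebra T)" if "s \<in> space S" for s
    by (rule bind_measure_pmf_in_prob_algebra[OF KT[OF that]])
  show ?thesis
  proof (rule measurable_prob_algebraI)
    show "prob_space (measure_pmf p \<bind> (\<lambda>z. K z s))" if "s \<in> space S" for s
      using bind[OF that] by (simp add: space_prob_algebra)
    show "(\<lambda>s. measure_pmf p \<bind> (\<lambda>z. K z s)) \<in> S \<rightarrow>\<^sub>M subprob_algebra T"
    proof (rule measurable_subprob_algebra)
      fix s assume s: "s \<in> space S"
      show "subprob_space (measure_pmf p \<bind> (\<lambda>z. K z s))"
        "sets (measure_pmf p \<bind> (\<lambda>z. K z s)) = sets T"
        using bind[OF s] by (auto simp: space_prob_algebra intro: prob_space_imp_subprob_space)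
    next
      fix A assume A: "A \<in> sets T"
      have "emeasure (measure_pmf p \<bind> (\<lambda>z. K z s)) A = (\<Sum>z\<in>set_pmf p. emeasure (K z s) A * pmf p z)"
        if "s \<in> space S" for s
        using emeasure_bind_prob_algebra[OF measure_pmf_in_prob_algebra[of p] _ A] fin KT[OF that]
        by (simp add: nn_integral_measure_pmf_finite)
      moreover have "(\<lambda>s. \<Sum>z\<in>set_pmf p. emeasure (K z s) A * pmf p z) \<in> borel_measurable S"
      proof (intro borel_measurable_sum borel_measurable_times_ennreal borel_measurable_const)
        show "(\<lambda>s. emeasure (K z s) A) \<in> borel_measurable S" if "z \<in> set_pmf p" for z
          by (rule measurable_emeasure_kernel[OF measurable_prob_algebraD[OF K[OF that]] A])
      qed
      ultimately show "(\<lambda>s. emeasure (measure_pmf p \<bind> (\<lambda>z. K z s)) A) \<in> borel_measurable S"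
        by (subst measurable_cong) auto
    qed
  qed
qed

lemma measurable_state_space:
  "fst \<in> state_space d n m \<rightarrow>\<^sub>M Rd_borel d"
  "i < n \<Longrightarrow> (\<lambda>s. fst (snd s) i) \<in> state_space d n m \<rightarrow>\<^sub>M Rd_borel d"
  "i < n \<Longrightarrow> j < m \<Longrightarrow> (\<lambda>s. snd (snd s) i j) \<in> state_space d n m \<rightarrow>\<^sub>M Rd_borel d"
proof -
  show "fst \<in> state_space d n m \<rightarrow>\<^sub>M Rd_borel d" unfolding state_space_def by measurable
  show "(\<lambda>s. fst (snd s) i) \<in> state_space d n m \<rightarrow>\<^sub>M Rd_borel d" if "i < n"
  proof -
    have i: "i \<in> {..<n}" using that by simp
    show ?thesis unfolding state_space_def using i by measurable
  qed
  show "(\<lambda>s. snd (snd s) i j) \<in> state_space d n m \<rightarrow>\<^sub>M Rd_borel d" if "i < n" "j < m"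
  proof -
    have i: "i \<in> {..<n}" and j: "j \<in> {..<m}" using that by simp_all
    have "(\<lambda>s. snd (snd s) i) \<in> state_space d n m \<rightarrow>\<^sub>M PiM {..<m} (\<lambda>_. Rd_borel d)"
      unfolding state_space_def using i by measurable
    from measurable_compose[OF this measurable_component_singleton[OF j]] show ?thesis .
  qed
qed

lemmas measurable_state_coord =
  measurable_compose[OF measurable_state_space(1) measurable_Rd_component]
  measurable_compose[OF measurable_state_space(2) measurable_Rd_component]
  measurable_compose[OF measurable_state_space(3) measurable_Rd_component]

lemma space_state_space:
  "space (state_space d n m) = Rd d \<times> ({..<n} \<rightarrow>\<^sub>E Rd d) \<times> ({..<n} \<rightarrow>\<^sub>E ({..<m} \<rightarrow>\<^sub>E Rd d))"
  by (simp add: state_space_def space_pair_measure space_PiM)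

lemma measurable_update:
  "(\<lambda>(s, \<Delta>). update v d n m \<alpha> \<gamma> u jj \<Delta> s)
     \<in> state_space d n m \<Otimes>\<^sub>M PiM {..<n} (\<lambda>_. Rd_borel d) \<rightarrow>\<^sub>M state_space d n m"
proof -
  let ?M = "state_space d n m \<Otimes>\<^sub>M PiM {..<n} (\<lambda>_. Rd_borel d)"
  have D: "(\<lambda>p. snd p i l) \<in> borel_measurable ?M" if "i < n" "l < d" for i l
  proof -
    have "i \<in> {..<n}" using that by simp
    then have "(\<lambda>p. snd p i) \<in> ?M \<rightarrow>\<^sub>M Rd_borel d" by measurable
    from measurable_compose[OF this measurable_Rd_component[OF that(2)]] show ?thesis .
  qed
  have x: "(\<lambda>p. fst (fst p) l) \<in> borel_measurable ?M" if "l < d" for l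
    using measurable_compose[OF measurable_fst measurable_state_coord(1)[OF that]] .
  have h: "(\<lambda>p. fst (snd (fst p)) i l) \<in> borel_measurable ?M" if "i < n" "l < d" for i l
    using measurable_compose[OF measurable_fst measurable_state_coord(2)[OF that]] .
  have X: "(\<lambda>p. fst (fst p)) \<in> ?M \<rightarrow>\<^sub>M Rd_borel d" 
    using measurable_compose[OF measurable_fst measurable_state_space(1)] .
  have W: "(\<lambda>p. snd (snd (fst p)) i j) \<in> ?M \<rightarrow>\<^sub>M Rd_borel d" if "i < n" "j < m" for i j
    using measurable_compose[OF measurable_fst measurable_state_space(3)[OF that]] .
  define M where "M = ?M"
  have "(\<lambda>p. (\<lambda>l\<in>{..<d}. fst (fst p) l - \<gamma> * ((\<Sum>i<n. snd p i l + fst (snd (fst p)) i l) / real n),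
      \<lambda>i\<in>{..<n}. \<lambda>l\<in>{..<d}. fst (snd (fst p)) i l + \<alpha> * snd p i l,
      \<lambda>i\<in>{..<n}. \<lambda>j\<in>{..<m}.
        (case v of
           L_SVRG \<Rightarrow> (if u then fst (fst p) else snd (snd (fst p)) i j)
         | SAGA \<Rightarrow> (if j = jj i then fst (fst p) else snd (snd (fst p)) i j)))) \<in> M \<rightarrow>\<^sub>M state_space d n m"
    unfolding state_space_def
  proof (intro measurable_Pair measurable_Rd_restrict measurable_restrict)
    fix i j assume "i \<in> {..<n}" "j \<in> {..<m}"
    then show "(\<lambda>p. case v of
           L_SVRG \<Rightarrow> (if u then fst (fst p) else snd (snd (fst p)) i j)
         | SAGA \<Rightarrow> (if j = jj i then fst (fst p) else snd (snd (fst p)) i j)) \<in> M \<rightarrow>\<^sub>M Rd_borel d"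
      using X W by (cases v; cases u; cases "j = jj i") (simp_all add: M_def)
  qed (use x h D in \<open>auto simp: M_def intro!: borel_measurable_diff borel_measurable_times
      borel_measurable_divide borel_measurable_sum borel_measurable_add\<close>)
  then show ?thesis by (simp add: update_def split_beta' M_def)
qed

definition message_law ::
    "nat \<Rightarrow> nat \<Rightarrow> nat \<Rightarrow> (nat \<Rightarrow> nat \<Rightarrow> vec \<Rightarrow> real) \<Rightarrow> (vec \<Rightarrow> vec measure) \<Rightarrow> (nat \<Rightarrow> nat) \<Rightarrow>
       state \<Rightarrow> (nat \<Rightarrow> vec) measure" where
  "message_law d n m f Q jj s = PiM {..<n} (\<lambda>i.
     Q (\<lambda>l\<in>{..<d}. grad_estimator d m (f i) (fst s) (snd (snd s) i) (jj i) l - fst (snd s) i l))"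

definition index_law :: "nat \<Rightarrow> nat \<Rightarrow> (nat \<Rightarrow> nat) pmf" where
  "index_law n m = Pi_pmf {..<n} 0 (\<lambda>_. pmf_of_set {..<m})"

lemma vr_diana_step_eq:
  "vr_diana_step v d n m f Q \<alpha> \<gamma> s =
     measure_pmf (bernoulli_pmf (1 / real m)) \<bind> (\<lambda>u. measure_pmf (index_law n m) \<bind> (\<lambda>jj.
       message_law d n m f Q jj s \<bind>
         (\<lambda>\<Delta>. return (state_space d n m) (update v d n m \<alpha> \<gamma> u jj \<Delta> s))))"
  by (simp add: vr_diana_step_def message_law_def index_law_def split_beta)

lemma set_index_law:
  assumes "m \<ge> 1"
  shows "finite (set_pmf (index_law n m))"
    and "jj \<in> set_pmf (index_law n m) \<Longrightarrow> i < n \<Longrightarrow> jj i < m"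
proof -
  have *: "set_pmf (pmf_of_set {..<m}) = {..<m}"
    using assms by (intro set_pmf_of_set) (auto simp: lessThan_empty_iff)
  show "finite (set_pmf (index_law n m))"
    unfolding index_law_def set_Pi_pmf[OF finite_lessThan] by (intro finite_PiE_dflt) (auto simp: *)
  show "jj \<in> set_pmf (index_law n m) \<Longrightarrow> i < n \<Longrightarrow> jj i < m"
    unfolding index_law_def set_Pi_pmf[OF finite_lessThan] by (auto simp: * PiE_dflt_def)
qed

text \<open>
  This holds for every index vector, inside the support or not, because the quantization kernel is
  defined on all of \<^term>\<open>Rd d\<close>.
\<close>

lemma message_law_in_prob_algebra:
  assumes Q: "Q \<in> Rd_borel d \<rightarrow>\<^sub>M prob_algebra (Rd_borel d)"
  shows "message_law d n m f Q jj s \<in> space (prob_algebra (PiM {..<n} (\<lambda>_. Rd_borel d)))"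
proof -
  have "Q z \<in> space (prob_algebra (Rd_borel d))" if "z \<in> Rd d" for z
    using measurable_space[OF Q, of z] that by simp
  then have "(\<lambda>s. message_law d n m f Q jj s)
      \<in> count_space UNIV \<rightarrow>\<^sub>M prob_algebra (PiM {..<n} (\<lambda>_. Rd_borel d))"
    unfolding message_law_def by (intro measurable_PiM_kernel) auto
  from measurable_space[OF this, of s] show ?thesis by simp
qed

lemma measurable_return_update:
  "(\<lambda>(s, \<Delta>). return (state_space d n m) (update v d n m \<alpha> \<gamma> u jj \<Delta> s))
     \<in> state_space d n m \<Otimes>\<^sub>M PiM {..<n} (\<lambda>_. Rd_borel d) \<rightarrow>\<^sub>M prob_algebra (state_space d n m)"
  using measurable_compose[OF measurable_update measurable_return_prob_space]
  by (simp add: split_beta')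

lemma measurable_return_update2:
  assumes "s \<in> space (state_space d n m)"
  shows "(\<lambda>\<Delta>. return (state_space d n m) (update v d n m \<alpha> \<gamma> u jj \<Delta> s))
     \<in> PiM {..<n} (\<lambda>_. Rd_borel d) \<rightarrow>\<^sub>M prob_algebra (state_space d n m)"
  using measurable_compose[OF measurable_Pair1'[OF assms] measurable_return_update] by simp

lemma message_step_in_prob_algebra:
  assumes Q: "Q \<in> Rd_borel d \<rightarrow>\<^sub>M prob_algebra (Rd_borel d)" and s: "s \<in> space (state_space d n m)"
  shows "message_law d n m f Q jj s \<bind>
         (\<lambda>\<Delta>. return (state_space d n m) (update v d n m \<alpha> \<gamma> u jj \<Delta> s))
       \<in> space (prob_algebra (state_space d n m))"
  using prob_space_bind'[OF message_law_in_prob_algebra[OF Q] measurable_return_update2[OF s]]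
    sets_bind'[OF message_law_in_prob_algebra[OF Q] measurable_return_update2[OF s]]
  by (simp add: space_prob_algebra)

lemma measurable_vr_diana_step:
  assumes Q: "Q \<in> Rd_borel d \<rightarrow>\<^sub>M prob_algebra (Rd_borel d)"
    and m: "m \<ge> 1"
    and f: "\<And>i j. i < n \<Longrightarrow> j < m \<Longrightarrow> convex_Rd d (f i j)"
           "\<And>i j. i < n \<Longrightarrow> j < m \<Longrightarrow> L_smooth d L (f i j)"
  shows "vr_diana_step v d n m f Q \<alpha> \<gamma> \<in> state_space d n m \<rightarrow>\<^sub>M prob_algebra (state_space d n m)"
proof -
  have G: "(\<lambda>s. grad d (f i j) (y s) l) \<in> borel_measurable (state_space d n m)"
    if "i < n" "j < m" "l < d" "y \<in> state_space d n m \<rightarrow>\<^sub>M Rd_borel d" for i j l y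
    using measurable_compose[OF that(4) measurable_grad[OF f(1)[OF that(1,2)] f(2)[OF that(1,2)] that(3)]] .
  have Gx: "(\<lambda>s. grad d (f i j) (fst s) l) \<in> borel_measurable (state_space d n m)"
    if "i < n" "j < m" "l < d" for i j l
    by (rule G[OF that measurable_state_space(1)])
  have Gw: "(\<lambda>s. grad d (f i j) (snd (snd s) i j) l) \<in> borel_measurable (state_space d n m)"
    if "i < n" "j < m" "l < d" for i j l
    by (rule G[OF that measurable_state_space(3)[OF that(1,2)]])
  have arg: "(\<lambda>s. \<lambda>l\<in>{..<d}. grad_estimator d m (f i) (fst s) (snd (snd s) i) (jj i) l - fst (snd s) i l)
      \<in> state_space d n m \<rightarrow>\<^sub>M Rd_borel d" if i: "i < n" "jj i < m" for i and jj :: "nat \<Rightarrow> nat"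
  proof (rule measurable_Rd_restrict)
    fix l assume l: "l < d"
    have "(\<lambda>s. grad d (f i (jj i)) (fst s) l - grad d (f i (jj i)) (snd (snd s) i (jj i)) l
        + (\<Sum>j<m. grad d (f i j) (snd (snd s) i j) l) / real m - fst (snd s) i l)
        \<in> borel_measurable (state_space d n m)"
      by (intro borel_measurable_diff borel_measurable_add borel_measurable_divide borel_measurable_const
          borel_measurable_sum Gx[OF i l] Gw[OF i l] Gw[OF i(1) _ l] measurable_state_coord(2)[OF i(1) l]) simp
    also have "(\<lambda>s. grad d (f i (jj i)) (fst s) l - grad d (f i (jj i)) (snd (snd s) i (jj i)) l
        + (\<Sum>j<m. grad d (f i j) (snd (snd s) i j) l) / real m - fst (snd s) i l)
      = (\<lambda>s :: state. grad_estimator d m (f i) (fst s) (snd (snd s) i) (jj i) l - fst (snd s) i l)"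
      using l by (simp add: grad_estimator_def fun_eq_iff)
    finally show "(\<lambda>s. grad_estimator d m (f i) (fst s) (snd (snd s) i) (jj i) l - fst (snd s) i l)
        \<in> borel_measurable (state_space d n m)" .
  qed
  have msg: "message_law d n m f Q jj \<in> state_space d n m \<rightarrow>\<^sub>M prob_algebra (PiM {..<n} (\<lambda>_. Rd_borel d))"
    if "jj \<in> set_pmf (index_law n m)" for jj
    unfolding message_law_def[abs_def]
    by (intro measurable_PiM_kernel measurable_compose[OF _ Q] arg)
       (auto simp: set_index_law(2)[OF m that])
  show ?thesis
    unfolding vr_diana_step_eq[abs_def]
  proof (intro measurable_bind_finite_pmf set_index_law m bind_measure_pmf_in_prob_algebra
      message_step_in_prob_algebra Q)
    fix u jj assume "jj \<in> set_pmf (index_law n m)"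
    then show "(\<lambda>s. message_law d n m f Q jj s \<bind>
         (\<lambda>\<Delta>. return (state_space d n m) (update v d n m \<alpha> \<gamma> u jj \<Delta> s)))
        \<in> state_space d n m \<rightarrow>\<^sub>M prob_algebra (state_space d n m)"
      by (intro measurable_bind_prob_space2[OF msg measurable_return_update])
  qed auto
qed

text \<open>
  Integration over one iteration is split into the coin, the indices and the messages, in this order
  from the outside to the inside.
\<close>

lemma nn_integral_vr_diana_step:
  assumes Q: "Q \<in> Rd_borel d \<rightarrow>\<^sub>M prob_algebra (Rd_borel d)" and s: "s \<in> space (state_space d n m)"
    and \<phi>: "\<phi> \<in> borel_measurable (state_space d n m)"
  shows "(\<integral>\<^sup>+ s'. \<phi> s' \<partial>vr_diana_step v d n m f Q \<alpha> \<gamma> s) =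
    (\<integral>\<^sup>+ u. \<integral>\<^sup>+ jj. \<integral>\<^sup>+ \<Delta>. \<phi> (update v d n m \<alpha> \<gamma> u jj \<Delta> s) \<partial>message_law d n m f Q jj s
        \<partial>measure_pmf (index_law n m) \<partial>measure_pmf (bernoulli_pmf (1 / real m)))"
proof -
  have sets: "sets (message_law d n m f Q jj s) = sets (PiM {..<n} (\<lambda>_. Rd_borel d))" for jj
    using message_law_in_prob_algebra[OF Q] by (auto simp: space_prob_algebra)
  have inner: "(\<integral>\<^sup>+ s'. \<phi> s' \<partial>(message_law d n m f Q jj s \<bind>
         (\<lambda>\<Delta>. return (state_space d n m) (update v d n m \<alpha> \<gamma> u jj \<Delta> s))))
      = (\<integral>\<^sup>+ \<Delta>. \<phi> (update v d n m \<alpha> \<gamma> u jj \<Delta> s) \<partial>message_law d n m f Q jj s)" for u jj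
  proof -
    have up: "(\<lambda>\<Delta>. update v d n m \<alpha> \<gamma> u jj \<Delta> s)
        \<in> message_law d n m f Q jj s \<rightarrow>\<^sub>M state_space d n m"
      using measurable_compose[OF measurable_Pair1'[OF s] measurable_update[where v=v and \<alpha>=\<alpha> and \<gamma>=\<gamma> and u=u and jj=jj]]
      by (simp add: measurable_cong_sets[OF sets refl])
    show ?thesis
      using measurable_return_update2[OF s, THEN measurable_prob_algebraD] \<phi> measurable_space[OF up]
      by (subst nn_integral_bind[where B="state_space d n m"])
         (auto simp: measurable_cong_sets[OF sets refl] nn_integral_return intro!: nn_integral_cong)
  qed
  have pa: "K \<in> space (subprob_algebra T)" if "K \<in> space (prob_algebra T)" for K :: "state measure" and T
    using that by (auto simp: space_prob_algebra space_subprob_algebra intro: prob_space_imp_subprob_space)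
  show ?thesis
    unfolding vr_diana_step_eq
    by (subst nn_integral_bind[OF \<phi>],
        simp add: pa bind_measure_pmf_in_prob_algebra message_step_in_prob_algebra[OF Q s],
        subst nn_integral_bind[OF \<phi>],
        simp add: pa message_step_in_prob_algebra[OF Q s], simp only: inner)
qed

section \<open>Second moments of sums of uncorrelated variables\<close>

text \<open>
  The bias-variance decomposition: after expanding the square, the mixed terms factor into products
  of expectations, so the diagonal alone deviates from the square of the mean.
\<close>

lemma (in prob_space) second_moment_sum_uncorrelated:
  fixes X :: "'i \<Rightarrow> 'a \<Rightarrow> real"
  assumes fin: "finite I"
    and int: "\<And>i. i \<in> I \<Longrightarrow> integrable M (X i)"
    and int2: "\<And>i j. i \<in> I \<Longrightarrow> j \<in> I \<Longrightarrow> integrable M (\<lambda>\<omega>. X i \<omega> * X j \<omega>)"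
    and unc: "\<And>i j. i \<in> I \<Longrightarrow> j \<in> I \<Longrightarrow> i \<noteq> j \<Longrightarrow>
       expectation (\<lambda>\<omega>. X i \<omega> * X j \<omega>) = expectation (X i) * expectation (X j)"
  shows "integrable M (\<lambda>\<omega>. (a + (\<Sum>i\<in>I. X i \<omega>))\<^sup>2)"
    and "expectation (\<lambda>\<omega>. (a + (\<Sum>i\<in>I. X i \<omega>))\<^sup>2) =
      (a + (\<Sum>i\<in>I. expectation (X i)))\<^sup>2
        + (\<Sum>i\<in>I. expectation (\<lambda>\<omega>. (X i \<omega>)\<^sup>2) - (expectation (X i))\<^sup>2)"
proof -
  have sq: "(a + (\<Sum>i\<in>I. Y i))\<^sup>2 = a\<^sup>2 + 2 * a * (\<Sum>i\<in>I. Y i) + (\<Sum>i\<in>I. \<Sum>j\<in>I. Y i * Y j)" for Y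
    by (simp add: power2_sum sum_product power2_eq_square[of "sum _ _"])
  show "integrable M (\<lambda>\<omega>. (a + (\<Sum>i\<in>I. X i \<omega>))\<^sup>2)"
    unfolding sq using int int2 by auto
  have "(\<Sum>i\<in>I. \<Sum>j\<in>I. expectation (\<lambda>\<omega>. X i \<omega> * X j \<omega>))
      = (\<Sum>i\<in>I. \<Sum>j\<in>I. expectation (X i) * expectation (X j)
          + (if i = j then expectation (\<lambda>\<omega>. (X i \<omega>)\<^sup>2) - (expectation (X i))\<^sup>2 else 0))"
    by (intro sum.cong refl) (auto simp: unc power2_eq_square)
  also have "\<dots> = (\<Sum>i\<in>I. \<Sum>j\<in>I. expectation (X i) * expectation (X j))
      + (\<Sum>i\<in>I. expectation (\<lambda>\<omega>. (X i \<omega>)\<^sup>2) - (expectation (X i))\<^sup>2)"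
    using fin by (simp add: sum.distrib)
  finally have cross: "(\<Sum>i\<in>I. \<Sum>j\<in>I. expectation (\<lambda>\<omega>. X i \<omega> * X j \<omega>)) = \<dots>" .
  have "expectation (\<lambda>\<omega>. (a + (\<Sum>i\<in>I. X i \<omega>))\<^sup>2)
      = a\<^sup>2 + 2 * a * (\<Sum>i\<in>I. expectation (X i)) + (\<Sum>i\<in>I. \<Sum>j\<in>I. expectation (\<lambda>\<omega>. X i \<omega> * X j \<omega>))"
    unfolding sq using int int2 by (simp add: prob_space)
  then show "expectation (\<lambda>\<omega>. (a + (\<Sum>i\<in>I. X i \<omega>))\<^sup>2) =
      (a + (\<Sum>i\<in>I. expectation (X i)))\<^sup>2
        + (\<Sum>i\<in>I. expectation (\<lambda>\<omega>. (X i \<omega>)\<^sup>2) - (expectation (X i))\<^sup>2)"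
    unfolding cross sq by simp
qed

lemma PiM_component_moments:
  fixes \<phi> :: "'a \<Rightarrow> real"
  assumes "\<And>i. i \<in> I \<Longrightarrow> prob_space (N i)" "i \<in> I" "integrable (N i) \<phi>"
  shows "integrable (PiM I N) (\<lambda>x. \<phi> (x i))" "(\<integral>x. \<phi> (x i) \<partial>PiM I N) = (\<integral>y. \<phi> y \<partial>N i)"
proof -
  have d: "distr (PiM I N) (N i) (\<lambda>x. x i) = N i"
    using assms by (intro distr_PiM_component)
  have m: "(\<lambda>x. x i) \<in> PiM I N \<rightarrow>\<^sub>M N i" using assms(2) by simp
  show "integrable (PiM I N) (\<lambda>x. \<phi> (x i))"
    using integrable_distr[OF m, of \<phi>] assms(3) by (simp add: d)
  show "(\<integral>x. \<phi> (x i) \<partial>PiM I N) = (\<integral>y. \<phi> y \<partial>N i)"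
    using integral_distr[OF m, of \<phi>] assms(3) by (simp add: d)
qed

text \<open>
  The two factors are completed by constant functions 1 to a product over all coordinates, to which
  Fubini's theorem applies.
\<close>

lemma PiM_product_moments:
  fixes \<phi> \<psi> :: "'a \<Rightarrow> real"
  assumes fin: "finite I" and N: "\<And>i. prob_space (N i)" and ij: "i \<in> I" "j \<in> I" "i \<noteq> j"
    and "integrable (N i) \<phi>" "integrable (N j) \<psi>"
  shows "integrable (PiM I N) (\<lambda>x. \<phi> (x i) * \<psi> (x j))"
    and "(\<integral>x. \<phi> (x i) * \<psi> (x j) \<partial>PiM I N) = (\<integral>y. \<phi> y \<partial>N i) * (\<integral>y. \<psi> y \<partial>N j)"
proof -
  interpret product_prob_space N I by (intro product_prob_spaceI N)
  define f where "f k = (if k = i then \<phi> else if k = j then \<psi> else (\<lambda>_. 1))" for k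
  have f: "integrable (N k) (f k)" for k
    using assms prob_space.finite_measure[OF N[of k]] by (auto simp: f_def finite_measure.integrable_const)
  have prod: "(\<Prod>k\<in>I. g k) = g i * g j" if "\<And>k. k \<noteq> i \<Longrightarrow> k \<noteq> j \<Longrightarrow> g k = 1" for g :: "'b \<Rightarrow> real"
  proof -
    have "(\<Prod>k\<in>I. g k) = (\<Prod>k\<in>{i,j}. g k)"
      using ij fin that by (intro prod.mono_neutral_right) auto
    then show ?thesis using ij by simp
  qed
  have "(\<Prod>k\<in>I. f k (x k)) = \<phi> (x i) * \<psi> (x j)" for x
    using ij by (subst prod) (auto simp: f_def)
  moreover have "(\<Prod>k\<in>I. integral\<^sup>L (N k) (f k)) = (\<integral>y. \<phi> y \<partial>N i) * (\<integral>y. \<psi> y \<partial>N j)"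
    using ij prob_space.prob_space[OF N] by (subst prod) (auto simp: f_def)
  ultimately show "integrable (PiM I N) (\<lambda>x. \<phi> (x i) * \<psi> (x j))"
    "(\<integral>x. \<phi> (x i) * \<psi> (x j) \<partial>PiM I N) = (\<integral>y. \<phi> y \<partial>N i) * (\<integral>y. \<psi> y \<partial>N j)"
    using product_integrable_prod[OF fin, of f] product_integral_prod[OF fin, of f] f by simp_all
qed

text \<open>
  The set \<open>J\<close> of workers serves two purposes: all workers together determine the new iterate, and a
  single worker determines its own shift vector. The factor \<open>\<omega>\<close> instead of \<open>\<omega> + 1\<close> appears because the
  squared mean is subtracted from the second moment.
\<close>

lemma quantization_second_moment:
  fixes z :: "nat \<Rightarrow> vec"
  assumes Q: "quantization_operator d \<omega> Q" and z: "\<And>i. z i \<in> Rd d" and J: "J \<subseteq> {..<n}"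
  shows "integrable (PiM {..<n} (\<lambda>i. Q (z i))) (\<lambda>\<Delta>. \<Sum>l<d. (a l + t * (\<Sum>i\<in>J. \<Delta> i l))\<^sup>2)"
    and "(\<integral>\<Delta>. (\<Sum>l<d. (a l + t * (\<Sum>i\<in>J. \<Delta> i l))\<^sup>2) \<partial>PiM {..<n} (\<lambda>i. Q (z i)))
      \<le> (\<Sum>l<d. (a l + t * (\<Sum>i\<in>J. z i l))\<^sup>2) + t\<^sup>2 * \<omega> * (\<Sum>i\<in>J. \<Sum>l<d. (z i l)\<^sup>2)"
proof -
  let ?N = "\<lambda>i. Q (z i)" and ?P = "PiM {..<n} (\<lambda>i. Q (z i))"
  have Qm: "Q \<in> Rd_borel d \<rightarrow>\<^sub>M prob_algebra (Rd_borel d)" using Q by (simp add: quantization_operator_def)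
  have N: "prob_space (?N i)" "sets (?N i) = sets (Rd_borel d)" for i
    using measurable_space[OF Qm, of "z i"] z by (auto simp: space_prob_algebra)
  have int1: "integrable (?N i) (\<lambda>y. y l)" and mean: "(\<integral>y. y l \<partial>?N i) = z i l" if "l < d" for i l
    using Q z[of i] that by (auto simp: quantization_operator_def)
  have intn: "integrable (?N i) (\<lambda>y. (norm2 d y)\<^sup>2)"
    and var: "(\<integral>y. (norm2 d y)\<^sup>2 \<partial>?N i) \<le> (\<omega> + 1) * (norm2 d (z i))\<^sup>2" for i
    using Q z[of i] by (auto simp: quantization_operator_def)
  have int2: "integrable (?N i) (\<lambda>y. (y l)\<^sup>2)" if l: "l < d" for i l
  proof (rule Bochner_Integration.integrable_bound[OF intn])
    show "(\<lambda>y. (y l)\<^sup>2) \<in> borel_measurable (?N i)"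
      using int1[OF l, of i] by (intro borel_measurable_power borel_measurable_integrable)
    show "AE y in ?N i. norm ((y l)\<^sup>2) \<le> norm ((norm2 d y)\<^sup>2)"
    proof (rule AE_I2)
      fix y
      have "(y l)\<^sup>2 \<le> (norm2 d y)\<^sup>2"
        unfolding norm2_sq by (rule member_le_sum) (use l in auto)
      then show "norm ((y l)\<^sup>2) \<le> norm ((norm2 d y)\<^sup>2)" by simp
    qed
  qed
  have P: "prob_space ?P" using N by (intro prob_space_PiM)
  interpret P: prob_space ?P by (rule P)
  have coord: "integrable ?P (\<lambda>\<Delta>. (a l + (\<Sum>i\<in>J. t * \<Delta> i l))\<^sup>2)"
      "(\<integral>\<Delta>. (a l + (\<Sum>i\<in>J. t * \<Delta> i l))\<^sup>2 \<partial>?P)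
        = (a l + (\<Sum>i\<in>J. t * z i l))\<^sup>2 + (\<Sum>i\<in>J. t\<^sup>2 * ((\<integral>y. (y l)\<^sup>2 \<partial>?N i) - (z i l)\<^sup>2))"
    if l: "l < d" for l
  proof -
    have J': "finite J" "\<And>i. i \<in> J \<Longrightarrow> i \<in> {..<n}" using J finite_subset[OF J] by auto
    have i1: "integrable ?P (\<lambda>\<Delta>. t * \<Delta> i l)" "(\<integral>\<Delta>. t * \<Delta> i l \<partial>?P) = t * z i l" if "i \<in> J" for i
      using PiM_component_moments[of "{..<n}" ?N i "\<lambda>y. y l"] N J'(2)[OF that] int1[OF l] mean[OF l] by auto
    have i2: "integrable ?P (\<lambda>\<Delta>. (\<Delta> i l)\<^sup>2)" "(\<integral>\<Delta>. (\<Delta> i l)\<^sup>2 \<partial>?P) = (\<integral>y. (y l)\<^sup>2 \<partial>?N i)" if "i \<in> J" for i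
      using PiM_component_moments[of "{..<n}" ?N i "\<lambda>y. (y l)\<^sup>2"] N J'(2)[OF that] int2[OF l] by auto
    have i3: "integrable ?P (\<lambda>\<Delta>. (t * \<Delta> i l) * (t * \<Delta> j l))"
        "(\<integral>\<Delta>. (t * \<Delta> i l) * (t * \<Delta> j l) \<partial>?P) = (t * z i l) * (t * z j l)"
      if "i \<in> J" "j \<in> J" "i \<noteq> j" for i j
      using PiM_product_moments[of "{..<n}" ?N i j "\<lambda>y. t * y l" "\<lambda>y. t * y l"] N J'(2) that
        int1[OF l] mean[OF l] by auto
    have i4: "integrable ?P (\<lambda>\<Delta>. (t * \<Delta> i l) * (t * \<Delta> j l))" if "i \<in> J" "j \<in> J" for i j
    proof (cases "i = j")
      case True
      then show ?thesis using integrable_mult_right[OF i2(1)[OF that(1)], of "t\<^sup>2"]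
        by (simp add: power2_eq_square algebra_simps)
    qed (use i3 that in auto)
    have 5: "(\<integral>\<Delta>. (t * \<Delta> i l) * (t * \<Delta> j l) \<partial>?P) = (\<integral>\<Delta>. t * \<Delta> i l \<partial>?P) * (\<integral>\<Delta>. t * \<Delta> j l \<partial>?P)"
      if "i \<in> J" "j \<in> J" "i \<noteq> j" for i j
      by (simp only: i1(2) i3(2) that if_True simp_thms)
    show "integrable ?P (\<lambda>\<Delta>. (a l + (\<Sum>i\<in>J. t * \<Delta> i l))\<^sup>2)"
      by (rule P.second_moment_sum_uncorrelated(1)[OF J'(1) i1(1) i4 5]) assumption+
    have *: "(\<integral>\<Delta>. (a l + (\<Sum>i\<in>J. t * \<Delta> i l))\<^sup>2 \<partial>?P)
        = (a l + (\<Sum>i\<in>J. (\<integral>\<Delta>. t * \<Delta> i l \<partial>?P)))\<^sup>2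
          + (\<Sum>i\<in>J. (\<integral>\<Delta>. (t * \<Delta> i l)\<^sup>2 \<partial>?P) - (\<integral>\<Delta>. t * \<Delta> i l \<partial>?P)\<^sup>2)"
      by (rule P.second_moment_sum_uncorrelated(2)[OF J'(1) i1(1) i4 5]) assumption+
    have "(\<Sum>i\<in>J. (\<integral>\<Delta>. (t * \<Delta> i l)\<^sup>2 \<partial>?P) - (\<integral>\<Delta>. t * \<Delta> i l \<partial>?P)\<^sup>2)
        = (\<Sum>i\<in>J. t\<^sup>2 * ((\<integral>y. (y l)\<^sup>2 \<partial>?N i) - (z i l)\<^sup>2))"
    proof (intro sum.cong refl)
      fix i assume i: "i \<in> J"
      have "(\<integral>\<Delta>. (t * \<Delta> i l)\<^sup>2 \<partial>?P) = t\<^sup>2 * (\<integral>y. (y l)\<^sup>2 \<partial>?N i)"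
        using i2[OF i] by (simp add: power_mult_distrib)
      then show "(\<integral>\<Delta>. (t * \<Delta> i l)\<^sup>2 \<partial>?P) - (\<integral>\<Delta>. t * \<Delta> i l \<partial>?P)\<^sup>2
          = t\<^sup>2 * ((\<integral>y. (y l)\<^sup>2 \<partial>?N i) - (z i l)\<^sup>2)"
        by (simp only: i1(2)[OF i] power_mult_distrib right_diff_distrib)
    qed
    then show "(\<integral>\<Delta>. (a l + (\<Sum>i\<in>J. t * \<Delta> i l))\<^sup>2 \<partial>?P)
        = (a l + (\<Sum>i\<in>J. t * z i l))\<^sup>2 + (\<Sum>i\<in>J. t\<^sup>2 * ((\<integral>y. (y l)\<^sup>2 \<partial>?N i) - (z i l)\<^sup>2))"
      unfolding * by (simp only: i1(2) cong: sum.cong)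
  qed
  show "integrable ?P (\<lambda>\<Delta>. \<Sum>l<d. (a l + t * (\<Sum>i\<in>J. \<Delta> i l))\<^sup>2)"
    using coord(1) by (intro Bochner_Integration.integrable_sum) (simp add: sum_distrib_left)
  have "(\<integral>\<Delta>. (\<Sum>l<d. (a l + t * (\<Sum>i\<in>J. \<Delta> i l))\<^sup>2) \<partial>?P)
      = (\<Sum>l<d. (a l + (\<Sum>i\<in>J. t * z i l))\<^sup>2 + (\<Sum>i\<in>J. t\<^sup>2 * ((\<integral>y. (y l)\<^sup>2 \<partial>?N i) - (z i l)\<^sup>2)))"
    using coord by (subst Bochner_Integration.integral_sum) (auto simp: sum_distrib_left)
  also have "\<dots> = (\<Sum>l<d. (a l + t * (\<Sum>i\<in>J. z i l))\<^sup>2)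
      + (\<Sum>i\<in>J. t\<^sup>2 * (\<Sum>l<d. (\<integral>y. (y l)\<^sup>2 \<partial>?N i) - (z i l)\<^sup>2))"
    by (simp add: sum.distrib sum_distrib_left sum.swap[of _ J])
  also have "(\<Sum>i\<in>J. t\<^sup>2 * (\<Sum>l<d. (\<integral>y. (y l)\<^sup>2 \<partial>?N i) - (z i l)\<^sup>2))
      \<le> (\<Sum>i\<in>J. t\<^sup>2 * (\<omega> * (\<Sum>l<d. (z i l)\<^sup>2)))"
  proof (intro sum_mono mult_left_mono)
    fix i
    have "(\<Sum>l<d. (\<integral>y. (y l)\<^sup>2 \<partial>?N i)) = (\<integral>y. (norm2 d y)\<^sup>2 \<partial>?N i)"
      unfolding norm2_sq using int2 by simp
    also have "\<dots> \<le> (\<omega> + 1) * (\<Sum>l<d. (z i l)\<^sup>2)" using var[of i] by (simp add: norm2_sq)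
    finally show "(\<Sum>l<d. (\<integral>y. (y l)\<^sup>2 \<partial>?N i) - (z i l)\<^sup>2) \<le> \<omega> * (\<Sum>l<d. (z i l)\<^sup>2)"
      by (simp add: sum_subtractf algebra_simps)
  qed simp
  finally show "(\<integral>\<Delta>. (\<Sum>l<d. (a l + t * (\<Sum>i\<in>J. \<Delta> i l))\<^sup>2) \<partial>?P)
      \<le> (\<Sum>l<d. (a l + t * (\<Sum>i\<in>J. z i l))\<^sup>2) + t\<^sup>2 * \<omega> * (\<Sum>i\<in>J. \<Sum>l<d. (z i l)\<^sup>2)"
    by (simp add: sum_distrib_left mult.assoc)
qed

section \<open>Averages and sampled indices\<close>

text \<open>
  Averages of finite sequences of numbers. Unlike \<^const>\<open>average\<close>, which averages functions, \<open>avg\<close>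
  applies to one coordinate at a time, which is how all estimates below proceed.
\<close>

definition avg :: "nat \<Rightarrow> (nat \<Rightarrow> real) \<Rightarrow> real" where
  "avg m a = (\<Sum>j<m. a j) / real m"

definition var :: "nat \<Rightarrow> (nat \<Rightarrow> real) \<Rightarrow> real" where
  "var m a = avg m (\<lambda>j. (a j)\<^sup>2) - (avg m a)\<^sup>2"

lemma avg_simps:
  "avg m (\<lambda>j. a j + b j) = avg m a + avg m b"
  "avg m (\<lambda>j. a j - b j) = avg m a - avg m b"
  "avg m (\<lambda>j. t * a j) = t * avg m a"
  "avg m (\<lambda>j. a j * t) = avg m a * t"
  "m \<ge> 1 \<Longrightarrow> avg m (\<lambda>j. t) = t"
  by (simp_all add: avg_def sum.distrib sum_subtractf add_divide_distrib diff_divide_distrib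
      sum_distrib_left sum_distrib_right)

lemma sum_eq_avg: "m \<ge> 1 \<Longrightarrow> (\<Sum>j<m. a j) = real m * avg m a"
  by (simp add: avg_def)

lemma avg_mono: "(\<And>j. j < m \<Longrightarrow> a j \<le> b j) \<Longrightarrow> avg m a \<le> avg m b"
  by (auto simp: avg_def intro!: divide_right_mono sum_mono)

lemma avg_sq_diff:
  assumes "m \<ge> 1"
  shows "avg m (\<lambda>j. (a j - y)\<^sup>2) = var m a + (avg m a - y)\<^sup>2"
  using assms by (simp add: var_def power2_diff avg_simps mult.assoc)

lemma avg_nonneg: "(\<And>j. j < m \<Longrightarrow> 0 \<le> a j) \<Longrightarrow> 0 \<le> avg m a"
  unfolding avg_def by (intro divide_nonneg_nonneg sum_nonneg) auto

lemma var_nonneg: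
  assumes "m \<ge> 1"
  shows "0 \<le> var m a"
proof -
  have "0 \<le> avg m (\<lambda>j. (a j - avg m a)\<^sup>2)" by (rule avg_nonneg) simp
  then show ?thesis using avg_sq_diff[OF assms, of a "avg m a"] by simp
qed

lemma var_shift:
  assumes "m \<ge> 1"
  shows "var m (\<lambda>j. a j + y) = var m a"
  using assms by (simp add: var_def power2_sum avg_simps mult.assoc)

lemma avg_square_le: "m \<ge> 1 \<Longrightarrow> (avg m a)\<^sup>2 \<le> avg m (\<lambda>j. (a j)\<^sup>2)"
  using var_nonneg[of m a] by (simp add: var_def)

lemma two_squares: "(a - b)\<^sup>2 \<le> 2 * (a - c)\<^sup>2 + 2 * (b - c)\<^sup>2" for a b c :: real
proof -
  have "2 * (a - c)\<^sup>2 + 2 * (b - c)\<^sup>2 - (a - b)\<^sup>2 = (a + b - 2 * c)\<^sup>2"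
    by (simp add: power2_eq_square algebra_simps)
  then show ?thesis by (metis diff_ge_0_iff_ge zero_le_power2)
qed

text \<open>
  The difference \<open>p - q\<close> is compared with the reference value \<open>r\<close>; for the estimators, \<open>p\<close>, \<open>q\<close> and \<open>r\<close>
  are component gradients at the iterate, at a reference point and at the minimizer.
\<close>

lemma var_diff_le:
  assumes "m \<ge> 1"
  shows "var m (\<lambda>j. p j - q j) \<le> 2 * avg m (\<lambda>j. (p j - r j)\<^sup>2) + 2 * avg m (\<lambda>j. (q j - r j)\<^sup>2)"
proof -
  have "var m (\<lambda>j. p j - q j) \<le> avg m (\<lambda>j. (p j - q j)\<^sup>2)" by (simp add: var_def)
  also have "\<dots> \<le> avg m (\<lambda>j. 2 * (p j - r j)\<^sup>2 + 2 * (q j - r j)\<^sup>2)"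
    by (intro avg_mono two_squares)
  finally show ?thesis by (simp add: avg_simps)
qed

lemma index_law_moments:
  assumes m: "m \<ge> 1" and i: "i < n"
  shows "measure_pmf.expectation (index_law n m) (\<lambda>jj. \<phi> (jj i)) = avg m \<phi>"
proof -
  have ne: "{..<m} \<noteq> {}" using m by (auto simp: lessThan_empty_iff)
  have "measure_pmf.expectation (index_law n m) (\<lambda>jj. \<phi> (jj i))
      = measure_pmf.expectation (map_pmf (\<lambda>jj. jj i) (index_law n m)) \<phi>"
    by simp
  also have "map_pmf (\<lambda>jj. jj i) (index_law n m) = pmf_of_set {..<m}"
    using i by (simp add: index_law_def Pi_pmf_component)
  finally show ?thesis using ne by (simp add: integral_pmf_of_set avg_def)
qed

lemma index_law_product_moments:
  assumes m: "m \<ge> 1" and i: "i < n" "i' < n" "i \<noteq> i'"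
  shows "measure_pmf.expectation (index_law n m) (\<lambda>jj. \<phi> (jj i) * \<psi> (jj i')) = avg m \<phi> * avg m \<psi>"
proof -
  let ?P = "measure_pmf (index_law n m)"
  define f where "f k = (if k = i then \<phi> else \<psi>)" for k
  have "prob_space.indep_vars ?P (\<lambda>_. count_space UNIV) (\<lambda>k jj. jj k) {..<n}"
    unfolding index_law_def by (rule indep_vars_Pi_pmf) simp
  then have "prob_space.indep_vars ?P (\<lambda>_. borel) (\<lambda>k jj. f k (jj k)) {..<n}"
    by (rule prob_space.indep_vars_compose2[OF prob_space_measure_pmf]) simp
  then have ind: "prob_space.indep_vars ?P (\<lambda>_. borel) (\<lambda>k jj. f k (jj k)) {i, i'}"
    by (rule prob_space.indep_vars_subset[OF prob_space_measure_pmf]) (use i in auto)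
  have "measure_pmf.expectation (index_law n m) (\<lambda>jj. \<Prod>k\<in>{i, i'}. f k (jj k))
      = (\<Prod>k\<in>{i, i'}. measure_pmf.expectation (index_law n m) (\<lambda>jj. f k (jj k)))"
    by (rule prob_space.indep_vars_lebesgue_integral[OF prob_space_measure_pmf _ ind])
       (auto intro: integrable_measure_pmf_finite set_index_law m)
  then show ?thesis
    using i by (simp add: index_law_moments[OF m] f_def)
qed

text \<open>
  Independence of the indices of different workers makes the sampling variances add up, in analogy
  to \<open>quantization_second_moment\<close>.
\<close>

lemma index_law_second_moment:
  assumes m: "m \<ge> 1"
  shows "measure_pmf.expectation (index_law n m)
      (\<lambda>jj. \<Sum>l<d. (a l + t * (\<Sum>i<n. X i (jj i) l))\<^sup>2)
    = (\<Sum>l<d. (a l + t * (\<Sum>i<n. avg m (\<lambda>j. X i j l)))\<^sup>2)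
      + t\<^sup>2 * (\<Sum>i<n. \<Sum>l<d. var m (\<lambda>j. X i j l))"
proof -
  let ?E = "measure_pmf.expectation (index_law n m)"
  have int: "integrable (measure_pmf (index_law n m)) F" for F :: "_ \<Rightarrow> real"
    by (rule integrable_measure_pmf_finite[OF set_index_law(1)[OF m]])
  have E1: "?E (\<lambda>jj. t * X i (jj i) l) = t * avg m (\<lambda>j. X i j l)"
    "?E (\<lambda>jj. (t * X i (jj i) l)\<^sup>2) = t\<^sup>2 * avg m (\<lambda>j. (X i j l)\<^sup>2)" if "i < n" for i l
    using index_law_moments[OF m that, of "\<lambda>j. t * X i j l"]
      index_law_moments[OF m that, of "\<lambda>j. (t * X i j l)\<^sup>2"]
    by (simp_all only: avg_simps power_mult_distrib)
  have E2: "?E (\<lambda>jj. (t * X i (jj i) l) * (t * X k (jj k) l))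
      = ?E (\<lambda>jj. t * X i (jj i) l) * ?E (\<lambda>jj. t * X k (jj k) l)"
    if "i \<in> {..<n}" "k \<in> {..<n}" "i \<noteq> k" for i k l
    using index_law_product_moments[OF m, of i n k "\<lambda>j. t * X i j l" "\<lambda>j. t * X k j l"] E1 that
    by (simp only: avg_simps lessThan_iff simp_thms)
  have "?E (\<lambda>jj. (a l + (\<Sum>i<n. t * X i (jj i) l))\<^sup>2)
      = (a l + (\<Sum>i<n. ?E (\<lambda>jj. t * X i (jj i) l)))\<^sup>2
        + (\<Sum>i<n. ?E (\<lambda>jj. (t * X i (jj i) l)\<^sup>2) - (?E (\<lambda>jj. t * X i (jj i) l))\<^sup>2)" for l
    by (rule prob_space.second_moment_sum_uncorrelated(2)[OF prob_space_measure_pmf finite_lessThan int int E2]) assumption+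
  also have "\<dots> l = (a l + (\<Sum>i<n. t * avg m (\<lambda>j. X i j l)))\<^sup>2
      + (\<Sum>i<n. t\<^sup>2 * var m (\<lambda>j. X i j l))" for l
    using E1 by (intro arg_cong2[where f = "(+)"] arg_cong[where f = "\<lambda>y. (a l + y)\<^sup>2"] sum.cong refl)
      (simp_all only: lessThan_iff power_mult_distrib right_diff_distrib var_def)
  finally have "?E (\<lambda>jj. (a l + t * (\<Sum>i<n. X i (jj i) l))\<^sup>2)
      = (a l + t * (\<Sum>i<n. avg m (\<lambda>j. X i j l)))\<^sup>2 + t\<^sup>2 * (\<Sum>i<n. var m (\<lambda>j. X i j l))" for l
    by (simp only: sum_distrib_left)
  then show ?thesis
    using int by (simp add: sum.distrib sum_distrib_left sum.swap[of _ "{..<n}"])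
qed

section \<open>The finite-sum problem\<close>

lemma average_avg: "average n F x = avg n (\<lambda>i. F i x)"
  by (simp add: average_def avg_def)

lemma inner_avg: "inner_prod d (\<lambda>l. avg m (\<lambda>j. r j l)) u = avg m (\<lambda>j. inner_prod d (r j) u)"
  unfolding inner_prod_def avg_def by (subst sum.swap) (simp add: sum_divide_distrib sum_distrib_right)

lemma avg_norm2_sq: "avg m (\<lambda>j. (norm2 d (a j))\<^sup>2) = (\<Sum>l<d. avg m (\<lambda>j. (a j l)\<^sup>2))"
  unfolding norm2_sq avg_def by (subst sum.swap) (simp add: sum_divide_distrib)

locale finite_sum_problem =
  fixes d n m :: nat and f :: "nat \<Rightarrow> nat \<Rightarrow> vec \<Rightarrow> real" and L \<mu> :: real and xs :: vec
  assumes n: "n \<ge> 1" and m: "m \<ge> 1"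
    and convex: "\<And>i j. i < n \<Longrightarrow> j < m \<Longrightarrow> convex_Rd d (f i j)"
    and smooth: "\<And>i j. i < n \<Longrightarrow> j < m \<Longrightarrow> L_smooth d L (f i j)"
    and strong: "\<And>i. i < n \<Longrightarrow> strongly_convex d \<mu> (average m (f i))"
    and xs: "xs \<in> Rd d"
    and minimal: "\<And>y. y \<in> Rd d \<Longrightarrow>
      average n (\<lambda>i. average m (f i)) xs \<le> average n (\<lambda>i. average m (f i)) y"
begin

abbreviation objective :: "vec \<Rightarrow> real" where
  "objective \<equiv> average n (\<lambda>i. average m (f i))"

lemma objective_avg: "objective y = avg n (\<lambda>i. avg m (\<lambda>j. f i j y))"
  by (simp add: average_avg)

lemma L_pos: "L > 0"
  using smooth[of 0 0] n m by (auto simp: L_smooth_def)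

lemma differentiable: "i < n \<Longrightarrow> j < m \<Longrightarrow> differentiable_Rd d (f i j)"
  using smooth by (auto simp: L_smooth_def)

lemma grad_worker:
  assumes "i < n" "x \<in> Rd d" "l < d"
  shows "grad d (average m (f i)) x l = avg m (\<lambda>j. grad d (f i j) x l)"
  using grad_average[OF m assms(2) differentiable[OF assms(1)]] assms(3) by (simp add: avg_def)

lemma inner_grad_worker:
  assumes "i < n" "x \<in> Rd d"
  shows "inner_prod d (grad d (average m (f i)) x) u = avg m (\<lambda>j. inner_prod d (grad d (f i j) x) u)"
  unfolding inner_avg[symmetric] by (rule inner_prod_cong) (simp_all add: grad_worker assms)

text \<open>
  A gradient step with step size \<open>1 / L\<close> decreases the objective by \<open>\<bar>v\<bar>\<^sup>2 / (2 * L)\<close>, where \<open>v\<close> is the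
  gradient. At a minimizer this forces \<open>v = 0\<close>.
\<close>

lemma minimizer_gradient_zero:
  assumes "l < d"
  shows "avg n (\<lambda>i. grad d (average m (f i)) xs l) = 0"
proof -
  define v where "v l = avg n (\<lambda>i. grad d (average m (f i)) xs l)" for l
  define y where "y = step_along d xs (- (1 / L)) v"
  have y: "y \<in> Rd d" by (simp add: y_def)
  have "avg n (\<lambda>i. avg m (\<lambda>j. f i j y))
      \<le> avg n (\<lambda>i. avg m (\<lambda>j. f i j xs + inner_prod d (grad d (f i j) xs) (y - xs)
          + L / 2 * (norm2 d (xs - y))\<^sup>2))"
    using smooth xs y by (intro avg_mono) (auto simp: L_smooth_def)
  also have "\<dots> = objective xs + avg n (\<lambda>i. avg m (\<lambda>j. inner_prod d (grad d (f i j) xs) (y - xs)))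
      + L / 2 * (norm2 d (xs - y))\<^sup>2"
    using n m by (simp add: avg_simps objective_avg)
  also have "avg n (\<lambda>i. avg m (\<lambda>j. inner_prod d (grad d (f i j) xs) (y - xs)))
      = avg n (\<lambda>i. inner_prod d (grad d (average m (f i)) xs) (y - xs))"
    using xs by (simp add: avg_def[of n] inner_grad_worker)
  also have "\<dots> = inner_prod d v (y - xs)" unfolding v_def inner_avg ..
  also have "\<dots> = - ((norm2 d v)\<^sup>2 / L)" by (simp add: y_def norm2_sq_inner)
  also have "L / 2 * (norm2 d (xs - y))\<^sup>2 = (norm2 d v)\<^sup>2 / L / 2"
    using L_pos by (simp add: norm2_minus_commute[of d xs] y_def power2_eq_square field_simps)
  finally have "objective y \<le> objective xs - (norm2 d v)\<^sup>2 / L / 2"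
    by (simp add: objective_avg)
  with minimal[OF y] have "(norm2 d v)\<^sup>2 / L / 2 \<le> 0" by linarith
  then have "norm2 d v = 0" using L_pos by (simp add: divide_le_0_iff zero_le_divide_iff)
  then show ?thesis using assms by (simp add: norm2_def L2_set_eq_0_iff v_def)
qed

text \<open>
  This gap is the exchange rate of the proof: all the noise that is produced at the iterate is bounded
  by its sum over the workers, which in turn is bounded by the gap of the objective.
\<close>

definition grad_gap :: "nat \<Rightarrow> vec \<Rightarrow> real" where
  "grad_gap i x = (\<Sum>l<d. avg m (\<lambda>j. (grad d (f i j) x l - grad d (f i j) xs l)\<^sup>2))"

text \<open>
  Averaging \<open>convex_smooth_lower_bound\<close> over all components kills the linear terms, since the average
  of the component gradients at the minimizer vanishes.
\<close>

lemma sum_grad_gap_le: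
  assumes x: "x \<in> Rd d"
  shows "(\<Sum>i<n. grad_gap i x) \<le> 2 * L * real n * (objective x - objective xs)"
proof -
  have "avg n (\<lambda>i. avg m (\<lambda>j. f i j xs + inner_prod d (grad d (f i j) xs) (x - xs)
      + (norm2 d (grad d (f i j) x - grad d (f i j) xs))\<^sup>2 * (1 / (2 * L))))
      \<le> avg n (\<lambda>i. avg m (\<lambda>j. f i j x))"
    using convex_smooth_lower_bound[OF convex smooth xs x] by (intro avg_mono) auto
  then have "objective xs + avg n (\<lambda>i. avg m (\<lambda>j. inner_prod d (grad d (f i j) xs) (x - xs)))
      + avg n (\<lambda>i. grad_gap i x) * (1 / (2 * L)) \<le> objective x"
    by (simp only: avg_simps objective_avg avg_norm2_sq grad_gap_def fun_diff_def)
  moreover have "avg n (\<lambda>i. avg m (\<lambda>j. inner_prod d (grad d (f i j) xs) (x - xs)))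
      = inner_prod d (\<lambda>l. avg n (\<lambda>i. grad d (average m (f i)) xs l)) (x - xs)"
    unfolding inner_avg using xs by (simp add: avg_def[of n] inner_grad_worker)
  moreover have "\<dots> = 0" by (simp add: inner_prod_def minimizer_gradient_zero)
  ultimately have "avg n (\<lambda>i. grad_gap i x) / (2 * L) \<le> objective x - objective xs"
    by simp
  then show ?thesis using L_pos n by (simp add: avg_def field_simps)
qed

text \<open>
  Strong convexity of each worker's function is used at the base point \<open>x\<close>, in the direction of the
  minimizer.
\<close>

lemma strong_convexity_bound:
  assumes x: "x \<in> Rd d"
  shows "(\<Sum>l<d. (x l - xs l) * avg n (\<lambda>i. grad d (average m (f i)) x l))
    \<ge> objective x - objective xs + \<mu> / 2 * (\<Sum>l<d. (x l - xs l)\<^sup>2)"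
proof -
  have "avg n (\<lambda>i. average m (f i) x + inner_prod d (grad d (average m (f i)) x) (xs - x)
      + \<mu> / 2 * (norm2 d (x - xs))\<^sup>2) \<le> avg n (\<lambda>i. average m (f i) xs)"
    using strong x xs by (intro avg_mono) (auto simp: strongly_convex_def)
  then have "objective x + inner_prod d (\<lambda>l. avg n (\<lambda>i. grad d (average m (f i)) x l)) (xs - x)
      + \<mu> / 2 * (norm2 d (x - xs))\<^sup>2 \<le> objective xs"
    using n by (simp add: avg_simps inner_avg average_avg[of n])
  moreover have "(\<Sum>l<d. (x l - xs l) * avg n (\<lambda>i. grad d (average m (f i)) x l))
      = - inner_prod d (\<lambda>l. avg n (\<lambda>i. grad d (average m (f i)) x l)) (xs - x)"
    by (simp add: inner_prod_def sum_negf[symmetric] algebra_simps)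
  ultimately show ?thesis by (simp add: norm2_sq)
qed

end

section \<open>Contraction of the Lyapunov function in one iteration\<close>

text \<open>
  The bookkeeping of constants, with each sum replaced by a number: \<open>S\<close> is the squared distance to the
  minimizer, \<open>\<Phi>\<close> the gap of the objective, \<open>A\<close> the sum of \<open>grad_gap\<close> over the workers, \<open>w\<close> the same
  for the reference points, \<open>H\<close> the error of the shifts, \<open>V\<close> the total sampling variance, and \<open>K\<close> and \<open>J\<close>
  the squared distances of the workers' gradients at \<open>x\<close> from the shifts and from their values at the
  minimizer. In units of \<open>\<gamma>\<^sup>2 * (\<omega> + 1) / n\<^sup>2\<close> the coefficient of \<open>A\<close> is at most
  \<open>4 + 12 + 16 = 32\<close>, from the noise of the iterate, the shifts and the reference points; the step size
  leaves room for 36.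
\<close>

lemma contraction_arithmetic:
  fixes n m :: nat and L \<mu> \<omega> \<alpha> \<gamma> b c \<rho> A H w S \<Phi> V K J :: real
  assumes n: "n \<ge> 1" and m: "m \<ge> 1" and L: "L > 0" and om: "\<omega> \<ge> 0"
    and al: "\<alpha> = 1 / (\<omega> + 1)" and ga: "\<gamma> = 1 / (L * (1 + 36 * (\<omega> + 1) / real n))"
    and b: "b = 4 * (\<omega> + 1) / (\<alpha> * (real n)\<^sup>2)" and c: "c = 16 * (\<omega> + 1) / (real n)\<^sup>2"
    and rho: "\<rho> \<le> \<gamma> * \<mu>" "\<rho> \<le> \<alpha> / 2" "\<rho> \<le> 3 / (8 * real m)"
    and nonneg: "A \<ge> 0" "H \<ge> 0" "w \<ge> 0" "S \<ge> 0"
    and V: "V \<le> 2 * A + 2 * w" and K: "K \<le> 2 * A + 2 * H" and J: "J \<le> A"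
    and \<Phi>: "A \<le> 2 * L * real n * \<Phi>"
  shows "S - 2 * \<gamma> * (\<Phi> + \<mu> / 2 * S) + \<gamma>\<^sup>2 * (A / real n)
      + (\<gamma> / real n)\<^sup>2 * (V + \<omega> * (V + K))
      + b * \<gamma>\<^sup>2 * ((1 - \<alpha>) * H + \<alpha> * (V + J))
      + c * \<gamma>\<^sup>2 * ((1 - 1 / real m) * (real m * w) + A)
    \<le> (1 - \<rho>) * (S + b * \<gamma>\<^sup>2 * H + c * \<gamma>\<^sup>2 * (real m * w))"
proof -
  define \<tau> where "\<tau> = (\<gamma> / real n)\<^sup>2"
  have tau: "\<tau> \<ge> 0" by (simp add: \<tau>_def)
  let ?o = "\<omega> + 1"
  have o: "?o \<ge> 1" using om by simp
  have g: "\<gamma> > 0" using L om n by (auto simp: ga intro!: divide_pos_pos mult_pos_pos add_pos_nonneg)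
  have ao: "\<alpha> * ?o = 1" using o by (simp add: al)
  have bg: "b * \<gamma>\<^sup>2 = 4 * ?o\<^sup>2 * \<tau>"
    using o n by (simp add: b al \<tau>_def power2_eq_square)
  have bga: "b * \<gamma>\<^sup>2 * \<alpha> = 4 * ?o * \<tau>"
    unfolding bg using o by (simp add: al power2_eq_square)
  have cg: "c * \<gamma>\<^sup>2 = 16 * ?o * \<tau>"
    using n by (simp add: c \<tau>_def power_divide)
  have mw: "(1 - 1 / real m) * (real m * w) = real m * w - w"
    using m by (simp add: field_simps)
  \<comment> \<open>the next three facts bound the part of each error term that has to be lost in one iteration\<close>
  have H: "\<rho> * (4 * ?o\<^sup>2 * \<tau> * H) \<le> 2 * ?o * \<tau> * H"
  proof -
    have "\<rho> * (4 * ?o\<^sup>2 * \<tau> * H) \<le> \<alpha> / 2 * (4 * ?o\<^sup>2 * \<tau> * H)"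
      using rho(2) tau nonneg by (intro mult_right_mono) auto
    also have "\<dots> = 2 * (\<alpha> * ?o) * ?o * \<tau> * H" by (simp add: power2_eq_square)
    finally show ?thesis by (simp only: ao mult_1_right)
  qed
  have W: "\<rho> * (16 * ?o * \<tau> * (real m * w)) \<le> 6 * ?o * \<tau> * w"
  proof -
    have "\<rho> * (16 * ?o * \<tau> * (real m * w)) \<le> 3 / (8 * real m) * (16 * ?o * \<tau> * (real m * w))"
      using rho(3) tau nonneg o by (intro mult_right_mono) auto
    also have "\<dots> = 6 * ?o * \<tau> * w" using m by simp
    finally show ?thesis .
  qed
  have S: "\<rho> * S \<le> \<gamma> * \<mu> * S" using rho(1) nonneg by (intro mult_right_mono) auto
  have oV: "5 * ?o * \<tau> * V \<le> 5 * ?o * \<tau> * (2 * A + 2 * w)"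
    using V o tau by (intro mult_left_mono) auto
  have oK: "\<omega> * \<tau> * K \<le> \<omega> * \<tau> * (2 * A + 2 * H)"
    using K om tau by (intro mult_left_mono) auto
  have oJ: "4 * ?o * \<tau> * J \<le> 4 * ?o * \<tau> * A"
    using J o tau by (intro mult_left_mono) auto
  have tA: "0 \<le> \<tau> * A" "0 \<le> \<tau> * H" "0 \<le> \<omega> * (\<tau> * A)" using tau nonneg om by auto
  \<comment> \<open>the gain of the full gradient step covers all the noise proportional to A;
    this inequality dictates the step size\<close>
  have A: "\<gamma>\<^sup>2 * (A / real n) + 36 * ?o * \<tau> * A \<le> 2 * \<gamma> * \<Phi>"
  proof -
    let ?k = "1 + 36 * ?o / real n"
    have k: "?k > 0" using o by (auto intro!: add_pos_nonneg)
    have "\<gamma>\<^sup>2 * (A / real n) + 36 * ?o * \<tau> * A = \<gamma>\<^sup>2 * ?k * (A / real n)"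
      using n by (simp add: \<tau>_def power2_eq_square field_simps)
    also have "\<dots> \<le> \<gamma>\<^sup>2 * ?k * (2 * L * \<Phi>)"
    proof (rule mult_left_mono)
      show "A / real n \<le> 2 * L * \<Phi>" using \<Phi> n by (simp add: divide_le_eq mult_ac)
      show "0 \<le> \<gamma>\<^sup>2 * ?k" using k by simp
    qed
    also have "\<dots> = 2 * \<gamma> * \<Phi> * (\<gamma> * (L * ?k))" by (simp add: power2_eq_square)
    also have "\<gamma> * (L * ?k) = 1" using k L by (simp add: ga)
    finally show ?thesis by simp
  qed
  have "b * \<gamma>\<^sup>2 * ((1 - \<alpha>) * H + \<alpha> * (V + J)) = b * \<gamma>\<^sup>2 * H + b * \<gamma>\<^sup>2 * \<alpha> * (V + J - H)"
    by (simp add: algebra_simps)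
  then have bb: "b * \<gamma>\<^sup>2 * ((1 - \<alpha>) * H + \<alpha> * (V + J)) = b * \<gamma>\<^sup>2 * H + 4 * ?o * \<tau> * (V + J - H)"
    by (simp only: bga)
  show ?thesis
    unfolding bb unfolding bg cg mw \<tau>_def[symmetric]
    using H W S oV oK oJ A tA by (simp add: algebra_simps)
qed

definition refreshed :: "variant \<Rightarrow> bool \<Rightarrow> (nat \<Rightarrow> nat) \<Rightarrow> nat \<Rightarrow> nat \<Rightarrow> bool" where
  "refreshed v u jj i j = (case v of L_SVRG \<Rightarrow> u | SAGA \<Rightarrow> j = jj i)"

text \<open>
  The two variants differ only here. Replacement has probability \<open>1 / m\<close> for each pair \<open>(i, j)\<close>,
  by the coin in one variant and by the sampled index in the other; linearity copes with the dependence
  between different pairs.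
\<close>

lemma expectation_refreshed:
  assumes m: "m \<ge> 1"
  shows "measure_pmf.expectation (bernoulli_pmf (1 / real m)) (\<lambda>u.
      measure_pmf.expectation (index_law n m) (\<lambda>jj.
        \<Sum>i<n. \<Sum>j<m. if refreshed v u jj i j then a i j else e i j))
    = (1 - 1 / real m) * (\<Sum>i<n. \<Sum>j<m. e i j) + (\<Sum>i<n. avg m (a i))"
proof (cases v)
  case L_SVRG
  have "(\<Sum>i<n. avg m (a i)) = (\<Sum>i<n. \<Sum>j<m. a i j) * (1 / real m)"
    by (simp add: avg_def sum_divide_distrib)
  moreover have "0 \<le> 1 / real m" "1 / real m \<le> 1" using m by auto
  ultimately show ?thesis
    by (simp add: L_SVRG refreshed_def mult.commute)
next
  case SAGA
  have int: "integrable (measure_pmf (index_law n m)) F" for F :: "_ \<Rightarrow> real"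
    by (rule integrable_measure_pmf_finite[OF set_index_law(1)[OF m]])
  have one: "measure_pmf.expectation (index_law n m) (\<lambda>jj. \<Sum>j<m. if j = jj i then a i j else e i j)
      = (1 - 1 / real m) * (\<Sum>j<m. e i j) + avg m (a i)" if "i < n" for i
  proof -
    \<comment> \<open>SAGA refreshes exactly one reference point per worker\<close>
    have "(\<Sum>j<m. if j = k then a i j else e i j) = (\<Sum>j<m. e i j) + (a i k - e i k)" if "k < m" for k
    proof -
      have "(\<Sum>j<m. if j = k then a i j else e i j) = (\<Sum>j<m. e i j + (if j = k then a i j - e i j else 0))"
        by (intro sum.cong) auto
      then show ?thesis using that by (simp add: sum.distrib)
    qed
    then have "avg m (\<lambda>k. \<Sum>j<m. if j = k then a i j else e i j) = avg m (\<lambda>k. (\<Sum>j<m. e i j) + (a i k - e i k))"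
      by (simp add: avg_def)
    also have "\<dots> = (\<Sum>j<m. e i j) + (avg m (a i) - avg m (e i))"
      using m by (simp add: avg_simps)
    also have "avg m (e i) = 1 / real m * (\<Sum>j<m. e i j)" by (simp add: avg_def)
    finally show ?thesis
      using index_law_moments[OF m that, of "\<lambda>k. \<Sum>j<m. if j = k then a i j else e i j"]
      by (simp add: algebra_simps)
  qed
  have "measure_pmf.expectation (index_law n m) (\<lambda>jj. \<Sum>i<n. \<Sum>j<m. if j = jj i then a i j else e i j)
      = (\<Sum>i<n. measure_pmf.expectation (index_law n m) (\<lambda>jj. \<Sum>j<m. if j = jj i then a i j else e i j))"
    by (rule Bochner_Integration.integral_sum) (rule int)
  also have "\<dots> = (\<Sum>i<n. (1 - 1 / real m) * (\<Sum>j<m. e i j) + avg m (a i))"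
    by (intro sum.cong refl one) simp
  finally show ?thesis
    by (simp add: SAGA refreshed_def sum.distrib sum_distrib_left)
qed

context finite_sum_problem
begin

abbreviation worker_grad :: "nat \<Rightarrow> vec \<Rightarrow> vec" where
  "worker_grad i \<equiv> grad d (average m (f i))"

definition memory_gap :: "nat \<Rightarrow> (nat \<Rightarrow> nat \<Rightarrow> vec) \<Rightarrow> real" where
  "memory_gap i w = (\<Sum>l<d. avg m (\<lambda>j. (grad d (f i j) (w i j) l - grad d (f i j) xs l)\<^sup>2))"

text \<open>
  The estimators are unbiased: the correction by the gradients at the reference points cancels on
  average.
\<close>

lemma avg_estimator:
  assumes "i < n" "l < d" "x \<in> Rd d"
  shows "avg m (\<lambda>j. grad_estimator d m (f i) x (w i) j l) = worker_grad i x l"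
proof -
  have "avg m (\<lambda>j. grad_estimator d m (f i) x (w i) j l)
      = avg m (\<lambda>j. grad d (f i j) x l - grad d (f i j) (w i j) l + avg m (\<lambda>j. grad d (f i j) (w i j) l))"
    using assms(2) by (simp add: grad_estimator_def avg_def)
  then show ?thesis using m assms by (simp add: avg_simps grad_worker)
qed

text \<open>
  The correction terms that are common to all indices shift the estimators by a constant and do not
  contribute to the variance.
\<close>

lemma var_estimator:
  assumes "i < n"
  shows "(\<Sum>l<d. var m (\<lambda>j. grad_estimator d m (f i) x (w i) j l)) \<le> 2 * grad_gap i x + 2 * memory_gap i w"
proof -
  have "(\<Sum>l<d. var m (\<lambda>j. grad_estimator d m (f i) x (w i) j l))
      = (\<Sum>l<d. var m (\<lambda>j. grad d (f i j) x l - grad d (f i j) (w i j) l))"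
  proof (rule sum.cong[OF refl])
    fix l assume "l \<in> {..<d}"
    then have "var m (\<lambda>j. grad_estimator d m (f i) x (w i) j l)
        = var m (\<lambda>j. (grad d (f i j) x l - grad d (f i j) (w i j) l) + avg m (\<lambda>j. grad d (f i j) (w i j) l))"
      by (simp add: grad_estimator_def avg_def)
    then show "var m (\<lambda>j. grad_estimator d m (f i) x (w i) j l)
        = var m (\<lambda>j. grad d (f i j) x l - grad d (f i j) (w i j) l)"
      by (simp only: var_shift[OF m])
  qed
  also have "\<dots> \<le> (\<Sum>l<d. 2 * avg m (\<lambda>j. (grad d (f i j) x l - grad d (f i j) xs l)\<^sup>2)
      + 2 * avg m (\<lambda>j. (grad d (f i j) (w i j) l - grad d (f i j) xs l)\<^sup>2))"
    by (intro sum_mono var_diff_le[OF m])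
  finally show ?thesis by (simp add: grad_gap_def memory_gap_def sum.distrib sum_distrib_left)
qed

lemma worker_grad_gap:
  assumes "i < n" "x \<in> Rd d"
  shows "(\<Sum>l<d. (worker_grad i x l - worker_grad i xs l)\<^sup>2) \<le> grad_gap i x"
  unfolding grad_gap_def
proof (rule sum_mono)
  fix l assume "l \<in> {..<d}"
  then have "worker_grad i x l - worker_grad i xs l = avg m (\<lambda>j. grad d (f i j) x l - grad d (f i j) xs l)"
    using assms xs by (simp add: grad_worker avg_simps)
  then show "(worker_grad i x l - worker_grad i xs l)\<^sup>2
      \<le> avg m (\<lambda>j. (grad d (f i j) x l - grad d (f i j) xs l)\<^sup>2)"
    by (simp add: avg_square_le[OF m])
qed

text \<open>
  Jensen's inequality over the workers, then over the components of each worker, after subtracting the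
  vanishing gradient at the minimizer.
\<close>

lemma objective_grad_sq_le:
  assumes x: "x \<in> Rd d"
  shows "(\<Sum>l<d. (avg n (\<lambda>i. worker_grad i x l))\<^sup>2) \<le> (\<Sum>i<n. grad_gap i x) / real n"
proof -
  have "(\<Sum>l<d. (avg n (\<lambda>i. worker_grad i x l))\<^sup>2)
      = (\<Sum>l<d. (avg n (\<lambda>i. worker_grad i x l - worker_grad i xs l))\<^sup>2)"
    by (intro sum.cong refl) (simp add: avg_simps minimizer_gradient_zero)
  also have "\<dots> \<le> (\<Sum>l<d. avg n (\<lambda>i. (worker_grad i x l - worker_grad i xs l)\<^sup>2))"
    by (intro sum_mono avg_square_le n)
  also have "\<dots> = avg n (\<lambda>i. \<Sum>l<d. (worker_grad i x l - worker_grad i xs l)\<^sup>2)"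
    unfolding avg_def by (subst sum.swap) (simp add: sum_divide_distrib)
  also have "\<dots> \<le> avg n (\<lambda>i. grad_gap i x)"
    by (intro avg_mono worker_grad_gap x)
  finally show ?thesis by (simp add: avg_def)
qed

lemma lyapunov_eq:
  "lyapunov d n m f b c \<gamma> xs (x, h, w) =
     (\<Sum>l<d. (x l - xs l)\<^sup>2) + b * \<gamma>\<^sup>2 * (\<Sum>i<n. \<Sum>l<d. (h i l - worker_grad i xs l)\<^sup>2)
     + c * \<gamma>\<^sup>2 * (real m * (\<Sum>i<n. memory_gap i w))"
proof -
  have "(\<Sum>j<m. (norm2 d (grad d (f i j) (w i j) - grad d (f i j) xs))\<^sup>2) = real m * memory_gap i w" for i
    unfolding sum_eq_avg[OF m] avg_norm2_sq by (simp add: memory_gap_def)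
  then show ?thesis by (simp add: lyapunov_def norm2_sq sum_distrib_left[of "real m", symmetric])
qed

text \<open>
  After an update, each part of the Lyapunov function has the form required by
  \<open>quantization_second_moment\<close>: an affine function of the messages of all workers for the iterate, and
  of the single worker \<open>i\<close> for its shift vector.
\<close>

lemma lyapunov_update_eq:
  "lyapunov d n m f b c \<gamma> xs (update v d n m \<alpha> \<gamma> u jj \<Delta> (x, h, w)) =
     (\<Sum>l<d. ((x l - xs l - \<gamma> / real n * (\<Sum>i<n. h i l)) + (- (\<gamma> / real n)) * (\<Sum>i<n. \<Delta> i l))\<^sup>2)
     + b * \<gamma>\<^sup>2 * (\<Sum>i<n. \<Sum>l<d. ((h i l - worker_grad i xs l) + \<alpha> * (\<Sum>k\<in>{i}. \<Delta> k l))\<^sup>2)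
     + c * \<gamma>\<^sup>2 * (\<Sum>i<n. \<Sum>j<m. if refreshed v u jj i j
          then (norm2 d (grad d (f i j) x - grad d (f i j) xs))\<^sup>2
          else (norm2 d (grad d (f i j) (w i j) - grad d (f i j) xs))\<^sup>2)"
proof -
  let ?s = "update v d n m \<alpha> \<gamma> u jj \<Delta> (x, h, w)"
  have x: "(norm2 d (fst ?s - xs))\<^sup>2 = (\<Sum>l<d. ((x l - xs l - \<gamma> / real n * (\<Sum>i<n. h i l))
      + (- (\<gamma> / real n)) * (\<Sum>i<n. \<Delta> i l))\<^sup>2)"
    unfolding norm2_sq
    by (intro sum.cong refl arg_cong[where f = "\<lambda>y. y\<^sup>2"])
       (simp add: update_def sum.distrib add_divide_distrib distrib_left)
  have h: "(norm2 d (fst (snd ?s) i - worker_grad i xs))\<^sup>2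
      = (\<Sum>l<d. ((h i l - worker_grad i xs l) + \<alpha> * (\<Sum>k\<in>{i}. \<Delta> k l))\<^sup>2)" if "i < n" for i
    unfolding norm2_sq using that
    by (intro sum.cong refl arg_cong[where f = "\<lambda>y. y\<^sup>2"]) (simp add: update_def)
  have w: "(norm2 d (grad d (f i j) (snd (snd ?s) i j) - grad d (f i j) xs))\<^sup>2
      = (if refreshed v u jj i j
          then (norm2 d (grad d (f i j) x - grad d (f i j) xs))\<^sup>2
          else (norm2 d (grad d (f i j) (w i j) - grad d (f i j) xs))\<^sup>2)" if "i < n" "j < m" for i j
    using that by (cases v) (simp_all add: update_def refreshed_def)
  have "lyapunov d n m f b c \<gamma> xs ?s = (norm2 d (fst ?s - xs))\<^sup>2
     + b * \<gamma>\<^sup>2 * (\<Sum>i<n. (norm2 d (fst (snd ?s) i - worker_grad i xs))\<^sup>2)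
     + c * \<gamma>\<^sup>2 * (\<Sum>i<n. \<Sum>j<m. (norm2 d (grad d (f i j) (snd (snd ?s) i j) - grad d (f i j) xs))\<^sup>2)"
    by (simp only: lyapunov_def split_beta)
  also have "(\<Sum>i<n. (norm2 d (fst (snd ?s) i - worker_grad i xs))\<^sup>2)
      = (\<Sum>i<n. \<Sum>l<d. ((h i l - worker_grad i xs l) + \<alpha> * (\<Sum>k\<in>{i}. \<Delta> k l))\<^sup>2)"
    by (rule sum.cong[OF refl], rule h) simp
  also have "(\<Sum>i<n. \<Sum>j<m. (norm2 d (grad d (f i j) (snd (snd ?s) i j) - grad d (f i j) xs))\<^sup>2)
      = (\<Sum>i<n. \<Sum>j<m. if refreshed v u jj i j
          then (norm2 d (grad d (f i j) x - grad d (f i j) xs))\<^sup>2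
          else (norm2 d (grad d (f i j) (w i j) - grad d (f i j) xs))\<^sup>2)"
    by (rule sum.cong[OF refl], rule sum.cong[OF refl], rule w) simp_all
  finally show ?thesis unfolding x .
qed

lemma lyapunov_nonneg: "b \<ge> 0 \<Longrightarrow> c \<ge> 0 \<Longrightarrow> 0 \<le> lyapunov d n m f b c \<gamma> xs s"
  by (cases s) (auto simp: lyapunov_def intro!: add_nonneg_nonneg mult_nonneg_nonneg sum_nonneg)

text \<open>
  The bound for the parts of the Lyapunov function that depend on the messages, after averaging over
  the quantization and for given indices \<open>jj\<close>. The weights \<open>1 - \<alpha>\<close> and \<open>\<alpha>\<close> of the shifts come from
  \<open>\<bar>p + \<alpha> * q\<bar>\<^sup>2 + \<alpha>\<^sup>2 * \<omega> * \<bar>q\<bar>\<^sup>2 = (1 - \<alpha>) * \<bar>p\<bar>\<^sup>2 + \<alpha> * \<bar>p + q\<bar>\<^sup>2\<close>,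
  which holds as \<open>\<alpha> * (\<omega> + 1) = 1\<close>.
\<close>

definition sampled_bound ::
    "real \<Rightarrow> real \<Rightarrow> real \<Rightarrow> real \<Rightarrow> vec \<Rightarrow> (nat \<Rightarrow> vec) \<Rightarrow> (nat \<Rightarrow> nat \<Rightarrow> vec) \<Rightarrow> (nat \<Rightarrow> nat) \<Rightarrow> real" where
  "sampled_bound \<omega> \<alpha> \<gamma> b x h w jj =
     (\<Sum>l<d. (x l - xs l + (- (\<gamma> / real n)) * (\<Sum>i<n. grad_estimator d m (f i) x (w i) (jj i) l))\<^sup>2)
     + (\<gamma> / real n)\<^sup>2 * (\<omega> * (\<Sum>i<n. \<Sum>l<d. (grad_estimator d m (f i) x (w i) (jj i) l - h i l)\<^sup>2))
     + b * \<gamma>\<^sup>2 * ((1 - \<alpha>) * (\<Sum>i<n. \<Sum>l<d. (h i l - worker_grad i xs l)\<^sup>2)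
       + \<alpha> * (\<Sum>i<n. \<Sum>l<d. (grad_estimator d m (f i) x (w i) (jj i) l - worker_grad i xs l)\<^sup>2))"

lemma message_average_le:
  assumes Q: "quantization_operator d \<omega> Q" and al: "\<alpha> = 1 / (\<omega> + 1)" and bc: "b \<ge> 0" "c \<ge> 0"
  shows "(\<integral>\<^sup>+ \<Delta>. ennreal (lyapunov d n m f b c \<gamma> xs (update v d n m \<alpha> \<gamma> u jj \<Delta> (x, h, w)))
        \<partial>message_law d n m f Q jj (x, h, w))
    \<le> ennreal (sampled_bound \<omega> \<alpha> \<gamma> b x h w jj + c * \<gamma>\<^sup>2 * (\<Sum>i<n. \<Sum>j<m. if refreshed v u jj i j
          then (norm2 d (grad d (f i j) x - grad d (f i j) xs))\<^sup>2
          else (norm2 d (grad d (f i j) (w i j) - grad d (f i j) xs))\<^sup>2))"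
proof -
  define z where "z i = (\<lambda>l\<in>{..<d}. grad_estimator d m (f i) x (w i) (jj i) l - h i l)" for i
  have z: "z i \<in> Rd d" for i by (simp add: z_def)
  let ?P = "PiM {..<n} (\<lambda>i. Q (z i))"
  have P: "message_law d n m f Q jj (x, h, w) = ?P"
    by (simp add: message_law_def z_def)
  have Qm: "Q \<in> Rd_borel d \<rightarrow>\<^sub>M prob_algebra (Rd_borel d)"
    using Q by (simp add: quantization_operator_def)
  have "prob_space (Q (z i))" for i
    using measurable_space[OF Qm, of "z i"] z by (auto simp: space_prob_algebra)
  then interpret P: prob_space ?P by (intro prob_space_PiM)
  let ?a = "\<lambda>l. x l - xs l - \<gamma> / real n * (\<Sum>i<n. h i l)" and ?t = "- (\<gamma> / real n)"
  let ?X = "\<lambda>\<Delta>. \<Sum>l<d. (?a l + ?t * (\<Sum>i<n. \<Delta> i l))\<^sup>2"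
  let ?H = "\<lambda>i \<Delta>. \<Sum>l<d. ((h i l - worker_grad i xs l) + \<alpha> * (\<Sum>k\<in>{i}. \<Delta> k l))\<^sup>2"
  let ?M = "\<Sum>i<n. \<Sum>j<m. if refreshed v u jj i j
          then (norm2 d (grad d (f i j) x - grad d (f i j) xs))\<^sup>2
          else (norm2 d (grad d (f i j) (w i j) - grad d (f i j) xs))\<^sup>2"
  let ?g = "\<lambda>i l. grad_estimator d m (f i) x (w i) (jj i) l"
  have iX: "integrable ?P ?X" and
    X: "integral\<^sup>L ?P ?X \<le> (\<Sum>l<d. (?a l + ?t * (\<Sum>i<n. z i l))\<^sup>2) + ?t\<^sup>2 * \<omega> * (\<Sum>i<n. \<Sum>l<d. (z i l)\<^sup>2)"
    by (rule quantization_second_moment[OF Q z]; simp)+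
  have iH: "integrable ?P (?H i)" and
    H: "integral\<^sup>L ?P (?H i) \<le> (\<Sum>l<d. ((h i l - worker_grad i xs l) + \<alpha> * (\<Sum>k\<in>{i}. z k l))\<^sup>2)
        + \<alpha>\<^sup>2 * \<omega> * (\<Sum>k\<in>{i}. \<Sum>l<d. (z k l)\<^sup>2)" if "i < n" for i
    by (rule quantization_second_moment[OF Q z]; use that in simp)+
  have X': "integral\<^sup>L ?P ?X \<le> (\<Sum>l<d. (x l - xs l + ?t * (\<Sum>i<n. ?g i l))\<^sup>2)
      + (\<gamma> / real n)\<^sup>2 * (\<omega> * (\<Sum>i<n. \<Sum>l<d. (?g i l - h i l)\<^sup>2))"
  proof -
    have "(\<Sum>l<d. (?a l + ?t * (\<Sum>i<n. z i l))\<^sup>2) = (\<Sum>l<d. (x l - xs l + ?t * (\<Sum>i<n. ?g i l))\<^sup>2)"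
      by (intro sum.cong refl arg_cong[where f = "\<lambda>y. y\<^sup>2"]) (simp add: z_def sum_subtractf algebra_simps)
    then show ?thesis using X by (simp add: z_def mult.assoc)
  qed
  have H': "integral\<^sup>L ?P (?H i) \<le> (1 - \<alpha>) * (\<Sum>l<d. (h i l - worker_grad i xs l)\<^sup>2)
      + \<alpha> * (\<Sum>l<d. (?g i l - worker_grad i xs l)\<^sup>2)" if i: "i < n" for i
  proof -
    have "\<omega> \<ge> 0" using Q by (simp add: quantization_operator_def)
    then have "\<alpha> * (\<omega> + 1) = 1" by (simp add: al)
    then have "\<alpha> * (\<alpha> * (\<omega> + 1)) = \<alpha>" by simp
    then have ao: "\<alpha> * \<alpha> * \<omega> = \<alpha> - \<alpha> * \<alpha>" by (simp add: algebra_simps)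
    have id: "(p + \<alpha> * q)\<^sup>2 + \<alpha> * \<alpha> * \<omega> * q\<^sup>2 = (1 - \<alpha>) * p\<^sup>2 + \<alpha> * (p + q)\<^sup>2" for p q :: real
      unfolding ao by (simp add: power2_eq_square algebra_simps)
    have "integral\<^sup>L ?P (?H i) \<le> (\<Sum>l<d. ((h i l - worker_grad i xs l) + \<alpha> * (?g i l - h i l))\<^sup>2
        + \<alpha> * \<alpha> * \<omega> * (?g i l - h i l)\<^sup>2)"
      using H[OF i] by (simp add: z_def sum.distrib sum_distrib_left power2_eq_square[of \<alpha>])
    also have "\<dots> = (1 - \<alpha>) * (\<Sum>l<d. (h i l - worker_grad i xs l)\<^sup>2)
        + \<alpha> * (\<Sum>l<d. (?g i l - worker_grad i xs l)\<^sup>2)"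
      unfolding id by (simp add: sum.distrib sum_distrib_left)
    finally show ?thesis .
  qed
  have iHs: "integrable ?P (\<lambda>\<Delta>. \<Sum>i<n. ?H i \<Delta>)"
    by (rule Bochner_Integration.integrable_sum, rule iH) simp
  have iS: "integrable ?P (\<lambda>\<Delta>. b * \<gamma>\<^sup>2 * (\<Sum>i<n. ?H i \<Delta>))"
    by (rule integrable_mult_right[OF iHs])
  have int: "integrable ?P (\<lambda>\<Delta>. ?X \<Delta> + b * \<gamma>\<^sup>2 * (\<Sum>i<n. ?H i \<Delta>) + c * \<gamma>\<^sup>2 * ?M)"
    by (rule Bochner_Integration.integrable_add[OF Bochner_Integration.integrable_add[OF iX iS] P.integrable_const])
  have "(\<integral>\<Delta>. (\<Sum>i<n. ?H i \<Delta>) \<partial>?P) = (\<Sum>i<n. integral\<^sup>L ?P (?H i))"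
    by (rule Bochner_Integration.integral_sum, rule iH) simp
  then have S: "(\<integral>\<Delta>. b * \<gamma>\<^sup>2 * (\<Sum>i<n. ?H i \<Delta>) \<partial>?P) = b * \<gamma>\<^sup>2 * (\<Sum>i<n. integral\<^sup>L ?P (?H i))"
    by (simp only: integral_mult_right_zero)
  have "(\<integral>\<Delta>. ?X \<Delta> + b * \<gamma>\<^sup>2 * (\<Sum>i<n. ?H i \<Delta>) + c * \<gamma>\<^sup>2 * ?M \<partial>?P)
      = integral\<^sup>L ?P ?X + b * \<gamma>\<^sup>2 * (\<Sum>i<n. integral\<^sup>L ?P (?H i)) + c * \<gamma>\<^sup>2 * ?M"
    by (simp only: Bochner_Integration.integral_add[OF Bochner_Integration.integrable_add[OF iX iS] P.integrable_const]
        Bochner_Integration.integral_add[OF iX iS] S lebesgue_integral_const P.prob_space scaleR_one)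
  also have "\<dots> \<le> sampled_bound \<omega> \<alpha> \<gamma> b x h w jj + c * \<gamma>\<^sup>2 * ?M"
  proof -
    have "b * \<gamma>\<^sup>2 * (\<Sum>i<n. integral\<^sup>L ?P (?H i)) \<le> b * \<gamma>\<^sup>2 * (\<Sum>i<n. (1 - \<alpha>) * (\<Sum>l<d. (h i l - worker_grad i xs l)\<^sup>2)
      + \<alpha> * (\<Sum>l<d. (?g i l - worker_grad i xs l)\<^sup>2))"
      using bc by (intro mult_left_mono sum_mono H') auto
    then show ?thesis using X' unfolding sampled_bound_def by (simp add: sum.distrib sum_distrib_left)
  qed
  finally have le: "(\<integral>\<Delta>. ?X \<Delta> + b * \<gamma>\<^sup>2 * (\<Sum>i<n. ?H i \<Delta>) + c * \<gamma>\<^sup>2 * ?M \<partial>?P)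
      \<le> sampled_bound \<omega> \<alpha> \<gamma> b x h w jj + c * \<gamma>\<^sup>2 * ?M" .
  have "(\<integral>\<^sup>+ \<Delta>. ennreal (?X \<Delta> + b * \<gamma>\<^sup>2 * (\<Sum>i<n. ?H i \<Delta>) + c * \<gamma>\<^sup>2 * ?M) \<partial>?P)
      = ennreal (\<integral>\<Delta>. ?X \<Delta> + b * \<gamma>\<^sup>2 * (\<Sum>i<n. ?H i \<Delta>) + c * \<gamma>\<^sup>2 * ?M \<partial>?P)"
  proof (rule nn_integral_eq_integral[OF int], rule AE_I2)
    show "0 \<le> ?X \<Delta> + b * \<gamma>\<^sup>2 * (\<Sum>i<n. ?H i \<Delta>) + c * \<gamma>\<^sup>2 * ?M" for \<Delta>
      using lyapunov_nonneg[OF bc, of \<gamma> "update v d n m \<alpha> \<gamma> u jj \<Delta> (x, h, w)"]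
      unfolding lyapunov_update_eq .
  qed
  also have "\<dots> \<le> ennreal (sampled_bound \<omega> \<alpha> \<gamma> b x h w jj + c * \<gamma>\<^sup>2 * ?M)"
    by (rule ennreal_leI[OF le])
  finally show ?thesis unfolding P lyapunov_update_eq .
qed

lemma sampled_bound_nonneg:
  assumes "\<omega> \<ge> 0" "0 \<le> \<alpha>" "\<alpha> \<le> 1" "b \<ge> 0"
  shows "0 \<le> sampled_bound \<omega> \<alpha> \<gamma> b x h w jj"
  unfolding sampled_bound_def using assms
  by (intro add_nonneg_nonneg mult_nonneg_nonneg sum_nonneg) auto

text \<open>
  Averaging over the indices replaces each estimator by its mean, the gradient of the worker, and adds
  its variance.
\<close>

lemma expectation_sampled_bound:
  fixes w :: "nat \<Rightarrow> nat \<Rightarrow> vec"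
  assumes x: "x \<in> Rd d"
  defines "V \<equiv> (\<Sum>i<n. \<Sum>l<d. var m (\<lambda>j. grad_estimator d m (f i) x (w i) j l))"
  shows "measure_pmf.expectation (index_law n m) (sampled_bound \<omega> \<alpha> \<gamma> b x h w) =
     (\<Sum>l<d. (x l - xs l - \<gamma> * avg n (\<lambda>i. worker_grad i x l))\<^sup>2)
     + (\<gamma> / real n)\<^sup>2 * (V + \<omega> * (V + (\<Sum>i<n. \<Sum>l<d. (worker_grad i x l - h i l)\<^sup>2)))
     + b * \<gamma>\<^sup>2 * ((1 - \<alpha>) * (\<Sum>i<n. \<Sum>l<d. (h i l - worker_grad i xs l)\<^sup>2)
       + \<alpha> * (V + (\<Sum>i<n. \<Sum>l<d. (worker_grad i x l - worker_grad i xs l)\<^sup>2)))"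
proof -
  let ?E = "measure_pmf.expectation (index_law n m)"
  let ?g = "\<lambda>i j l. grad_estimator d m (f i) x (w i) j l"
  have int: "integrable (measure_pmf (index_law n m)) F" for F :: "_ \<Rightarrow> real"
    by (rule integrable_measure_pmf_finite[OF set_index_law(1)[OF m]])
  have sq: "?E (\<lambda>jj. \<Sum>i<n. \<Sum>l<d. (?g i (jj i) l - y i l)\<^sup>2)
      = V + (\<Sum>i<n. \<Sum>l<d. (worker_grad i x l - y i l)\<^sup>2)" for y
  proof -
    have "?E (\<lambda>jj. \<Sum>i<n. \<Sum>l<d. (?g i (jj i) l - y i l)\<^sup>2)
        = (\<Sum>i<n. \<Sum>l<d. ?E (\<lambda>jj. (?g i (jj i) l - y i l)\<^sup>2))"
      using int by simp
    also have "\<dots> = (\<Sum>i<n. \<Sum>l<d. var m (\<lambda>j. ?g i j l) + (worker_grad i x l - y i l)\<^sup>2)"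
    proof (intro sum.cong refl)
      fix i l assume "i \<in> {..<n}" "l \<in> {..<d}"
      then show "?E (\<lambda>jj. (?g i (jj i) l - y i l)\<^sup>2) = var m (\<lambda>j. ?g i j l) + (worker_grad i x l - y i l)\<^sup>2"
        using index_law_moments[OF m, of i n "\<lambda>j. (?g i j l - y i l)\<^sup>2"]
          avg_sq_diff[OF m, of "\<lambda>j. ?g i j l" "y i l"] avg_estimator[OF _ _ x, of i l w] by simp
    qed
    finally show ?thesis by (simp add: V_def sum.distrib)
  qed
  have first: "?E (\<lambda>jj. \<Sum>l<d. (x l - xs l + (- (\<gamma> / real n)) * (\<Sum>i<n. ?g i (jj i) l))\<^sup>2)
      = (\<Sum>l<d. (x l - xs l - \<gamma> * avg n (\<lambda>i. worker_grad i x l))\<^sup>2) + (\<gamma> / real n)\<^sup>2 * V"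
  proof -
    have "x l - xs l + (- (\<gamma> / real n)) * (\<Sum>i<n. avg m (\<lambda>j. ?g i j l))
        = x l - xs l - \<gamma> * avg n (\<lambda>i. worker_grad i x l)" if "l < d" for l
      using that x by (simp add: avg_estimator avg_def[of n])
    then have "(\<Sum>l<d. (x l - xs l + (- (\<gamma> / real n)) * (\<Sum>i<n. avg m (\<lambda>j. ?g i j l)))\<^sup>2)
        = (\<Sum>l<d. (x l - xs l - \<gamma> * avg n (\<lambda>i. worker_grad i x l))\<^sup>2)"
      by (intro sum.cong refl arg_cong[where f = "\<lambda>y. y\<^sup>2"]) simp
    then show ?thesis
      unfolding index_law_second_moment[OF m, of n "\<lambda>l. x l - xs l" _ "\<lambda>i j l. ?g i j l"] V_def
      by (simp only: power2_minus)
  qed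
  have "?E (sampled_bound \<omega> \<alpha> \<gamma> b x h w)
      = ?E (\<lambda>jj. \<Sum>l<d. (x l - xs l + (- (\<gamma> / real n)) * (\<Sum>i<n. ?g i (jj i) l))\<^sup>2)
      + (\<gamma> / real n)\<^sup>2 * (\<omega> * ?E (\<lambda>jj. \<Sum>i<n. \<Sum>l<d. (?g i (jj i) l - h i l)\<^sup>2))
      + b * \<gamma>\<^sup>2 * ((1 - \<alpha>) * (\<Sum>i<n. \<Sum>l<d. (h i l - worker_grad i xs l)\<^sup>2)
       + \<alpha> * ?E (\<lambda>jj. \<Sum>i<n. \<Sum>l<d. (?g i (jj i) l - worker_grad i xs l)\<^sup>2))"
    unfolding sampled_bound_def[abs_def]
    by (simp only: Bochner_Integration.integral_add[OF int int] integral_mult_right_zero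
        lebesgue_integral_const measure_pmf.prob_space scaleR_one)
  then show ?thesis unfolding first sq by (simp add: algebra_simps)
qed

text \<open>
  The one-step contraction: the messages are averaged first, then the indices and the coin, and the
  resulting sums are fed into \<open>contraction_arithmetic\<close>.
\<close>

theorem expected_lyapunov_contraction:
  assumes Q: "quantization_operator d \<omega> Q" and al: "\<alpha> = 1 / (\<omega> + 1)"
    and ga: "\<gamma> = 1 / (L * (1 + 36 * (\<omega> + 1) / real n))"
    and b: "b = 4 * (\<omega> + 1) / (\<alpha> * (real n)\<^sup>2)" and c: "c = 16 * (\<omega> + 1) / (real n)\<^sup>2"
    and rho: "\<rho> \<le> \<gamma> * \<mu>" "\<rho> \<le> \<alpha> / 2" "\<rho> \<le> 3 / (8 * real m)"
    and x: "x \<in> Rd d"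
  shows "(\<integral>\<^sup>+ u. \<integral>\<^sup>+ jj. \<integral>\<^sup>+ \<Delta>. ennreal (lyapunov d n m f b c \<gamma> xs (update v d n m \<alpha> \<gamma> u jj \<Delta> (x, h, w)))
        \<partial>message_law d n m f Q jj (x, h, w)
        \<partial>measure_pmf (index_law n m) \<partial>measure_pmf (bernoulli_pmf (1 / real m)))
    \<le> ennreal ((1 - \<rho>) * lyapunov d n m f b c \<gamma> xs (x, h, w))"
proof -
  have om: "\<omega> \<ge> 0" using Q by (simp add: quantization_operator_def)
  have al': "0 < \<alpha>" "\<alpha> \<le> 1" using om by (auto simp: al)
  have bc: "b \<ge> 0" "c \<ge> 0" using om al' by (auto simp: b c)
  have ga': "\<gamma> > 0" using om L_pos by (auto simp: ga intro!: mult_pos_pos add_pos_nonneg)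
  let ?a = "\<lambda>i j. (norm2 d (grad d (f i j) x - grad d (f i j) xs))\<^sup>2"
  let ?e = "\<lambda>i j. (norm2 d (grad d (f i j) (w i j) - grad d (f i j) xs))\<^sup>2"
  let ?M = "\<lambda>u jj. \<Sum>i<n. \<Sum>j<m. if refreshed v u jj i j then ?a i j else ?e i j"
  let ?T = "sampled_bound \<omega> \<alpha> \<gamma> b x h w"
  let ?J = "measure_pmf.expectation (index_law n m)"
  let ?U = "measure_pmf.expectation (bernoulli_pmf (1 / real m))"
  have intJ: "integrable (measure_pmf (index_law n m)) F" for F :: "_ \<Rightarrow> real"
    by (rule integrable_measure_pmf_finite[OF set_index_law(1)[OF m]])
  have intU: "integrable (measure_pmf (bernoulli_pmf (1 / real m))) F" for F :: "_ \<Rightarrow> real"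
    by (rule integrable_measure_pmf_finite) simp
  have T0: "0 \<le> ?T jj" for jj using om al' bc by (intro sampled_bound_nonneg) auto
  have M0: "0 \<le> ?M u jj" for u jj by (intro sum_nonneg) auto
  have TM0: "0 \<le> ?T jj + c * \<gamma>\<^sup>2 * ?M u jj" for u jj
    using T0 M0 bc by (intro add_nonneg_nonneg mult_nonneg_nonneg) auto
  have "(\<integral>\<^sup>+ u. \<integral>\<^sup>+ jj. \<integral>\<^sup>+ \<Delta>. ennreal (lyapunov d n m f b c \<gamma> xs (update v d n m \<alpha> \<gamma> u jj \<Delta> (x, h, w)))
        \<partial>message_law d n m f Q jj (x, h, w)
        \<partial>measure_pmf (index_law n m) \<partial>measure_pmf (bernoulli_pmf (1 / real m)))
    \<le> (\<integral>\<^sup>+ u. \<integral>\<^sup>+ jj. ennreal (?T jj + c * \<gamma>\<^sup>2 * ?M u jj)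
        \<partial>measure_pmf (index_law n m) \<partial>measure_pmf (bernoulli_pmf (1 / real m)))"
    by (intro nn_integral_mono message_average_le[OF Q al bc])
  also have "\<dots> = (\<integral>\<^sup>+ u. ennreal (?J (\<lambda>jj. ?T jj + c * \<gamma>\<^sup>2 * ?M u jj)) \<partial>measure_pmf (bernoulli_pmf (1 / real m)))"
    by (intro nn_integral_cong nn_integral_eq_integral intJ AE_I2 TM0)
  also have "\<dots> = ennreal (?U (\<lambda>u. ?J (\<lambda>jj. ?T jj + c * \<gamma>\<^sup>2 * ?M u jj)))"
    by (intro nn_integral_eq_integral intU AE_I2 Bochner_Integration.integral_nonneg TM0)
  also have "?U (\<lambda>u. ?J (\<lambda>jj. ?T jj + c * \<gamma>\<^sup>2 * ?M u jj)) = ?J ?T + c * \<gamma>\<^sup>2 * ?U (\<lambda>u. ?J (\<lambda>jj. ?M u jj))"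
    by (simp only: Bochner_Integration.integral_add[OF intJ intJ] Bochner_Integration.integral_add[OF intU intU]
        integral_mult_right_zero lebesgue_integral_const measure_pmf.prob_space scaleR_one)
  also have "?U (\<lambda>u. ?J (\<lambda>jj. ?M u jj)) = (1 - 1 / real m) * (\<Sum>i<n. \<Sum>j<m. ?e i j) + (\<Sum>i<n. avg m (?a i))"
    by (rule expectation_refreshed[OF m])
  also have "(\<Sum>i<n. \<Sum>j<m. ?e i j) = real m * (\<Sum>i<n. memory_gap i w)"
    unfolding sum_eq_avg[OF m] avg_norm2_sq by (simp add: memory_gap_def sum_distrib_left[symmetric])
  also have "(\<Sum>i<n. avg m (?a i)) = (\<Sum>i<n. grad_gap i x)"
    unfolding avg_norm2_sq by (simp add: grad_gap_def)
  also have "?J ?T + c * \<gamma>\<^sup>2 * ((1 - 1 / real m) * (real m * (\<Sum>i<n. memory_gap i w)) + (\<Sum>i<n. grad_gap i x))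
      \<le> (1 - \<rho>) * lyapunov d n m f b c \<gamma> xs (x, h, w)"
  proof -
    define S where "S = (\<Sum>l<d. (x l - xs l)\<^sup>2)"
    define A where "A = (\<Sum>i<n. grad_gap i x)"
    define W where "W = (\<Sum>i<n. memory_gap i w)"
    define H where "H = (\<Sum>i<n. \<Sum>l<d. (h i l - worker_grad i xs l)\<^sup>2)"
    define V where "V = (\<Sum>i<n. \<Sum>l<d. var m (\<lambda>j. grad_estimator d m (f i) x (w i) j l))"
    define K where "K = (\<Sum>i<n. \<Sum>l<d. (worker_grad i x l - h i l)\<^sup>2)"
    define J where "J = (\<Sum>i<n. \<Sum>l<d. (worker_grad i x l - worker_grad i xs l)\<^sup>2)"
    define \<Phi> where "\<Phi> = objective x - objective xs"
    have V: "V \<le> 2 * A + 2 * W"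
      using sum_mono[of "{..<n}", OF var_estimator[of _ x w]]
      by (simp add: V_def A_def W_def sum.distrib sum_distrib_left)
    have J: "J \<le> A" unfolding J_def A_def by (intro sum_mono worker_grad_gap x) simp
    have "K \<le> (\<Sum>i<n. \<Sum>l<d. 2 * (worker_grad i x l - worker_grad i xs l)\<^sup>2 + 2 * (h i l - worker_grad i xs l)\<^sup>2)"
      unfolding K_def by (intro sum_mono two_squares)
    also have "\<dots> = 2 * J + 2 * H" by (simp add: J_def H_def sum.distrib sum_distrib_left[symmetric])
    finally have K: "K \<le> 2 * A + 2 * H" using J by simp
    have \<Phi>: "A \<le> 2 * L * real n * \<Phi>" unfolding A_def \<Phi>_def by (rule sum_grad_gap_le[OF x])
    have nonneg: "A \<ge> 0" "H \<ge> 0" "W \<ge> 0" "S \<ge> 0"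
      by (auto simp: A_def H_def W_def S_def grad_gap_def memory_gap_def intro!: sum_nonneg avg_nonneg)
    have grad_step: "(\<Sum>l<d. (x l - xs l - \<gamma> * avg n (\<lambda>i. worker_grad i x l))\<^sup>2)
        \<le> S - 2 * \<gamma> * (\<Phi> + \<mu> / 2 * S) + \<gamma>\<^sup>2 * (A / real n)"
    proof -
      have "(\<Sum>l<d. (x l - xs l - \<gamma> * avg n (\<lambda>i. worker_grad i x l))\<^sup>2)
          = S - 2 * \<gamma> * (\<Sum>l<d. (x l - xs l) * avg n (\<lambda>i. worker_grad i x l))
            + \<gamma>\<^sup>2 * (\<Sum>l<d. (avg n (\<lambda>i. worker_grad i x l))\<^sup>2)"
        unfolding S_def sum_distrib_left sum_subtractf[symmetric] sum.distrib[symmetric]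
        by (intro sum.cong refl) (simp add: power2_eq_square algebra_simps)
      moreover have "2 * \<gamma> * (\<Phi> + \<mu> / 2 * S) \<le> 2 * \<gamma> * (\<Sum>l<d. (x l - xs l) * avg n (\<lambda>i. worker_grad i x l))"
        using strong_convexity_bound[OF x] ga' unfolding \<Phi>_def S_def by (intro mult_left_mono) auto
      moreover have "\<gamma>\<^sup>2 * (\<Sum>l<d. (avg n (\<lambda>i. worker_grad i x l))\<^sup>2) \<le> \<gamma>\<^sup>2 * (A / real n)"
        using objective_grad_sq_le[OF x] unfolding A_def by (intro mult_left_mono) auto
      ultimately show ?thesis by linarith
    qed
    show ?thesis
      using contraction_arithmetic[OF n m L_pos om al ga b c rho nonneg V K J \<Phi>] grad_step
      unfolding expectation_sampled_bound[OF x] lyapunov_eq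
        S_def[symmetric] A_def[symmetric] W_def[symmetric] H_def[symmetric] V_def[symmetric]
        K_def[symmetric] J_def[symmetric]
      by linarith
  qed
  finally show ?thesis by (simp add: ennreal_leI)
qed

end

section \<open>The Lyapunov function along the chain\<close>

context finite_sum_problem
begin

lemma measurable_lyapunov:
  "lyapunov d n m f b c \<gamma> xs \<in> borel_measurable (state_space d n m)"
proof -
  have x: "(\<lambda>s. fst s l) \<in> borel_measurable (state_space d n m)" if "l < d" for l
    by (rule measurable_state_coord(1)[OF that])
  have h: "(\<lambda>s. fst (snd s) i l) \<in> borel_measurable (state_space d n m)" if "i \<in> {..<n}" "l \<in> {..<d}" for i l
    by (rule measurable_state_coord(2)) (use that in auto)
  have g: "(\<lambda>s. grad d (f i j) (snd (snd s) i j) l) \<in> borel_measurable (state_space d n m)"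
    if "i \<in> {..<n}" "j \<in> {..<m}" "l \<in> {..<d}" for i j l
    by (rule measurable_compose[OF measurable_state_space(3) measurable_grad[OF convex smooth]])
       (use that in auto)
  have "(\<lambda>s. (\<Sum>l<d. (fst s l - xs l)\<^sup>2)
     + b * \<gamma>\<^sup>2 * (\<Sum>i<n. \<Sum>l<d. (fst (snd s) i l - grad d (average m (f i)) xs l)\<^sup>2)
     + c * \<gamma>\<^sup>2 * (\<Sum>i<n. \<Sum>j<m. \<Sum>l<d. (grad d (f i j) (snd (snd s) i j) l - grad d (f i j) xs l)\<^sup>2))
     \<in> borel_measurable (state_space d n m)"
    by (intro borel_measurable_add borel_measurable_times borel_measurable_sum borel_measurable_power
        borel_measurable_diff borel_measurable_const x h g) (simp_all only: lessThan_iff)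
  then show ?thesis
    by (simp only: lyapunov_def[abs_def] split_beta' norm2_sq fun_diff_def)
qed

lemma vr_diana_in_prob_algebra:
  assumes Q: "quantization_operator d \<omega> Q" and s0: "s0 \<in> space (state_space d n m)"
  shows "vr_diana v d n m f Q \<alpha> \<gamma> s0 k \<in> space (prob_algebra (state_space d n m))"
proof (induction k)
  case 0
  show ?case using s0 by (simp add: space_prob_algebra prob_space_return)
next
  case (Suc k)
  have Qm: "Q \<in> Rd_borel d \<rightarrow>\<^sub>M prob_algebra (Rd_borel d)" using Q by (simp add: quantization_operator_def)
  note step = measurable_vr_diana_step[OF Qm m convex smooth]
  show ?case
    using prob_space_bind'[OF Suc step] sets_bind'[OF Suc step] by (simp add: space_prob_algebra)
qed

text \<open>
  Nonnegative integrals need no integrability, so the contraction can be iterated before anything is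
  known about moments of the iterates.
\<close>

lemma nn_integral_lyapunov_vr_diana:
  assumes Q: "quantization_operator d \<omega> Q" and al: "\<alpha> = 1 / (\<omega> + 1)"
    and ga: "\<gamma> = 1 / (L * (1 + 36 * (\<omega> + 1) / real n))"
    and b: "b = 4 * (\<omega> + 1) / (\<alpha> * (real n)\<^sup>2)" and c: "c = 16 * (\<omega> + 1) / (real n)\<^sup>2"
    and rho: "\<rho> \<le> \<gamma> * \<mu>" "\<rho> \<le> \<alpha> / 2" "\<rho> \<le> 3 / (8 * real m)"
    and s0: "s0 \<in> space (state_space d n m)"
  shows "(\<integral>\<^sup>+ s. ennreal (lyapunov d n m f b c \<gamma> xs s) \<partial>vr_diana v d n m f Q \<alpha> \<gamma> s0 k)
    \<le> ennreal ((1 - \<rho>) ^ k * lyapunov d n m f b c \<gamma> xs s0)"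
proof (induction k)
  case 0
  show ?case
    using s0 measurable_lyapunov by (simp add: nn_integral_return)
next
  case (Suc k)
  let ?\<psi> = "lyapunov d n m f b c \<gamma> xs" and ?D = "vr_diana v d n m f Q \<alpha> \<gamma> s0 k"
  have om: "\<omega> \<ge> 0" using Q by (simp add: quantization_operator_def)
  then have "\<alpha> \<le> 1" by (simp add: al)
  then have rho1: "0 \<le> 1 - \<rho>" using rho(2) by simp
  have Qm: "Q \<in> Rd_borel d \<rightarrow>\<^sub>M prob_algebra (Rd_borel d)" using Q by (simp add: quantization_operator_def)
  have sets: "sets ?D = sets (state_space d n m)"
    using vr_diana_in_prob_algebra[OF Q s0, of v \<alpha> \<gamma> k] by (simp add: space_prob_algebra)
  have psi: "(\<lambda>s. ennreal (?\<psi> s)) \<in> borel_measurable (state_space d n m)"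
    by (rule measurable_compose[OF measurable_lyapunov measurable_ennreal])
  have step: "vr_diana_step v d n m f Q \<alpha> \<gamma> \<in> ?D \<rightarrow>\<^sub>M subprob_algebra (state_space d n m)"
    using measurable_prob_algebraD[OF measurable_vr_diana_step[OF Qm m convex smooth]]
    by (simp only: measurable_cong_sets[OF sets refl])
  have "(\<integral>\<^sup>+ s. ennreal (?\<psi> s) \<partial>vr_diana v d n m f Q \<alpha> \<gamma> s0 (Suc k))
      = (\<integral>\<^sup>+ s. \<integral>\<^sup>+ s'. ennreal (?\<psi> s') \<partial>vr_diana_step v d n m f Q \<alpha> \<gamma> s \<partial>?D)"
    by (simp add: nn_integral_bind[OF psi step])
  also have "\<dots> \<le> (\<integral>\<^sup>+ s. ennreal (1 - \<rho>) * ennreal (?\<psi> s) \<partial>?D)"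
  proof (rule nn_integral_mono)
    fix s assume "s \<in> space ?D"
    then have s: "s \<in> space (state_space d n m)" by (simp add: sets_eq_imp_space_eq[OF sets])
    obtain x h w where xhw: "s = (x, h, w)" by (cases s)
    have x: "x \<in> Rd d" using s by (simp add: xhw space_state_space)
    have "(\<integral>\<^sup>+ s'. ennreal (?\<psi> s') \<partial>vr_diana_step v d n m f Q \<alpha> \<gamma> s) \<le> ennreal ((1 - \<rho>) * ?\<psi> s)"
      unfolding nn_integral_vr_diana_step[OF Qm s psi] unfolding xhw
      by (rule expected_lyapunov_contraction[OF Q al ga b c rho x])
    then show "(\<integral>\<^sup>+ s'. ennreal (?\<psi> s') \<partial>vr_diana_step v d n m f Q \<alpha> \<gamma> s)
        \<le> ennreal (1 - \<rho>) * ennreal (?\<psi> s)"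
      by (simp only: ennreal_mult'[OF rho1])
  qed
  also have "\<dots> = ennreal (1 - \<rho>) * (\<integral>\<^sup>+ s. ennreal (?\<psi> s) \<partial>?D)"
    using psi by (intro nn_integral_cmult) (simp only: measurable_cong_sets[OF sets refl])
  also have "\<dots> \<le> ennreal (1 - \<rho>) * ennreal ((1 - \<rho>) ^ k * ?\<psi> s0)"
    by (rule mult_left_mono[OF Suc]) simp
  also have "\<dots> = ennreal ((1 - \<rho>) ^ Suc k * ?\<psi> s0)"
    by (simp only: ennreal_mult'[OF rho1, symmetric] power_Suc mult.assoc)
  finally show ?case .
qed

lemma iterate_error_le:
  fixes v :: variant and k :: nat
  assumes Q: "quantization_operator d \<omega> Q" and al: "\<alpha> = 1 / (\<omega> + 1)"
    and ga: "\<gamma> = 1 / (L * (1 + 36 * (\<omega> + 1) / real n))"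
    and b: "b = 4 * (\<omega> + 1) / (\<alpha> * (real n)\<^sup>2)" and c: "c = 16 * (\<omega> + 1) / (real n)\<^sup>2"
    and rho: "\<rho> \<le> \<gamma> * \<mu>" "\<rho> \<le> \<alpha> / 2" "\<rho> \<le> 3 / (8 * real m)"
    and s0: "s0 \<in> space (state_space d n m)"
  defines "D \<equiv> vr_diana v d n m f Q \<alpha> \<gamma> s0 k"
  shows "integrable D (\<lambda>s. (norm2 d (fst s - xs))\<^sup>2)"
    and "(\<integral>s. (norm2 d (fst s - xs))\<^sup>2 \<partial>D) \<le> (1 - \<rho>) ^ k * lyapunov d n m f b c \<gamma> xs s0"
proof -
  let ?\<psi> = "lyapunov d n m f b c \<gamma> xs"
  have om: "\<omega> \<ge> 0" using Q by (simp add: quantization_operator_def)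
  then have al': "0 \<le> \<alpha>" "\<alpha> \<le> 1" by (auto simp: al)
  then have rho1: "0 \<le> 1 - \<rho>" using rho(2) by simp
  have bc: "b \<ge> 0" "c \<ge> 0" using om al' by (auto simp: b c)
  have sets: "sets D = sets (state_space d n m)"
    using vr_diana_in_prob_algebra[OF Q s0, of v \<alpha> \<gamma> k] by (simp add: space_prob_algebra D_def)
  \<comment> \<open>with zero weights the Lyapunov function is the squared distance, whose measurability follows\<close>
  have "lyapunov d n m f 0 0 \<gamma> xs = (\<lambda>s. (norm2 d (fst s - xs))\<^sup>2)"
    by (auto simp: lyapunov_def)
  then have meas: "(\<lambda>s. (norm2 d (fst s - xs))\<^sup>2) \<in> borel_measurable D"
    using measurable_lyapunov[of 0 0 \<gamma>] by (simp only: measurable_cong_sets[OF sets refl])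
  have "(norm2 d (fst s - xs))\<^sup>2 \<le> ?\<psi> s" for s
    using bc by (cases s) (auto simp: lyapunov_def intro!: add_nonneg_nonneg mult_nonneg_nonneg sum_nonneg)
  then have "(\<integral>\<^sup>+ s. ennreal ((norm2 d (fst s - xs))\<^sup>2) \<partial>D) \<le> (\<integral>\<^sup>+ s. ennreal (?\<psi> s) \<partial>D)"
    by (intro nn_integral_mono ennreal_leI)
  also have "\<dots> \<le> ennreal ((1 - \<rho>) ^ k * ?\<psi> s0)"
    unfolding D_def by (rule nn_integral_lyapunov_vr_diana[OF Q al ga b c rho s0])
  finally have le: "(\<integral>\<^sup>+ s. ennreal ((norm2 d (fst s - xs))\<^sup>2) \<partial>D) \<le> ennreal ((1 - \<rho>) ^ k * ?\<psi> s0)" .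
  show int: "integrable D (\<lambda>s. (norm2 d (fst s - xs))\<^sup>2)"
    using le_less_trans[OF le ennreal_less_top] by (intro integrableI_bounded meas) simp
  have "ennreal (\<integral>s. (norm2 d (fst s - xs))\<^sup>2 \<partial>D) \<le> ennreal ((1 - \<rho>) ^ k * ?\<psi> s0)"
    using le nn_integral_eq_integral[OF int] by simp
  then show "(\<integral>s. (norm2 d (fst s - xs))\<^sup>2 \<partial>D) \<le> (1 - \<rho>) ^ k * ?\<psi> s0"
    by (rule ennreal_le_iff[THEN iffD1, rotated]) (intro mult_nonneg_nonneg zero_le_power rho1 lyapunov_nonneg bc)
qed

end

lemma geometric_decay:
  fixes \<rho> \<epsilon> :: real
  assumes "0 < \<rho>" "\<rho> \<le> 1" "0 < \<epsilon>" "real k \<ge> 1 / \<rho> * ln (1 / \<epsilon>)"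
  shows "(1 - \<rho>) ^ k \<le> \<epsilon>"
proof -
  have "(1 - \<rho>) ^ k \<le> exp (- \<rho>) ^ k"
    using exp_ge_add_one_self[of "- \<rho>"] assms by (intro power_mono) auto
  also have "\<dots> = exp (- (\<rho> * real k))" by (simp add: exp_of_nat_mult[symmetric] mult.commute)
  also have "\<dots> \<le> exp (ln \<epsilon>)"
  proof -
    have "ln (1 / \<epsilon>) \<le> \<rho> * real k" using assms(1,4) by (simp add: field_simps)
    then have "- (\<rho> * real k) \<le> ln \<epsilon>" using assms(3) by (simp add: ln_div)
    then show ?thesis by (simp only: exp_le_cancel_iff)
  qed
  finally show ?thesis using assms(3) by simp
qed

text \<open>
  The three admissible rates against the complexity \<open>D\<close>. In the first one,
  \<open>1 / (\<gamma> * \<mu>) = \<kappa> * (1 + 36 * (\<omega> + 1) / n) \<le> 37 * \<kappa> + 36 * \<kappa> * \<omega> / n\<close>, which is where 37 comes from.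
\<close>

lemma rate_le:
  fixes n m :: nat
  assumes n: "n \<ge> 1" and m: "m \<ge> 1" and L: "L > 0" and \<mu>: "\<mu> > 0" and om: "\<omega> \<ge> 0"
  defines "D \<equiv> L / \<mu> + L / \<mu> * (\<omega> / real n) + real m + \<omega>"
  shows "D \<ge> 1"
    and "1 / (37 * D) \<le> 1 / (L * (1 + 36 * (\<omega> + 1) / real n)) * \<mu>"
    and "1 / (37 * D) \<le> 1 / (\<omega> + 1) / 2"
    and "1 / (37 * D) \<le> 3 / (8 * real m)"
proof -
  let ?k = "L / \<mu>"
  have k: "?k > 0" "0 \<le> ?k * (\<omega> / real n)" using L \<mu> om by auto
  show D: "D \<ge> 1" unfolding D_def using k m om by linarith
  have D37: "37 * D = 37 * ?k + 37 * (?k * (\<omega> / real n)) + 37 * real m + 37 * \<omega>"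
    by (simp only: D_def distrib_left)
  have lin: "A \<le> 37 * p + 37 * q + 37 * M + 37 * o'"
    if "A = p + 36 * q + 36 * e" "e \<le> p * 1" "0 \<le> q" "0 \<le> M" "0 \<le> o'" for A p q e M o' :: real
    using that by simp
  have "?k * (1 + 36 * (\<omega> + 1) / real n) = ?k + 36 * (?k * (\<omega> / real n)) + 36 * (?k * (1 / real n))"
    by (simp add: distrib_left add_divide_distrib mult.commute)
  moreover have "?k * (1 / real n) \<le> ?k * 1"
    using n k by (intro mult_left_mono) auto
  ultimately have "?k * (1 + 36 * (\<omega> + 1) / real n) \<le> 37 * D"
    unfolding D37 by (rule lin) (use k om in simp_all)
  moreover have pos: "0 < 1 + 36 * (\<omega> + 1) / real n" using om by (intro add_pos_nonneg) auto
  ultimately have "1 / (37 * D) \<le> 1 / (?k * (1 + 36 * (\<omega> + 1) / real n))"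
    using k by (intro divide_left_mono mult_pos_pos) (use D in auto)
  also have "\<dots> = 1 / (L * (1 + 36 * (\<omega> + 1) / real n)) * \<mu>" using \<mu> L pos by simp
  finally show "1 / (37 * D) \<le> 1 / (L * (1 + 36 * (\<omega> + 1) / real n)) * \<mu>" .
  have "2 * (\<omega> + 1) \<le> 37 * D" unfolding D37 using k om m by simp
  then show "1 / (37 * D) \<le> 1 / (\<omega> + 1) / 2"
    using om D by (simp add: frac_le)
  have "8 * real m \<le> 3 * (37 * D)" unfolding D37 using k om m by simp
  then show "1 / (37 * D) \<le> 3 / (8 * real m)"
    using m D by (simp add: divide_simps)
qed

theorem corollary2:
  shows "\<exists>C::real. C > 0 \<and>
    (\<forall>(v::variant) (d::nat) (n::nat) (m::nat) (f :: nat \<Rightarrow> nat \<Rightarrow> vec \<Rightarrow> real)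
       (L::real) (\<mu>::real) (\<kappa>::real) (\<omega>::real) (Q :: vec \<Rightarrow> vec measure)
       (\<alpha>::real) (\<gamma>::real) (b::real) (c::real) (xs::vec)
       (x0::vec) (h0 :: nat \<Rightarrow> vec) (w0 :: nat \<Rightarrow> nat \<Rightarrow> vec) (\<psi>0::real).
       n \<ge> 1 \<and> m \<ge> 1 \<and>
       (\<forall>i<n. \<forall>j<m. convex_Rd d (f i j) \<and> L_smooth d L (f i j)) \<and>
       \<mu> > 0 \<and> (\<forall>i<n. strongly_convex d \<mu> (average m (f i))) \<and>
       \<kappa> = L / \<mu> \<and>
       xs \<in> Rd d \<and>
       (\<forall>y\<in>Rd d. average n (\<lambda>i. average m (f i)) xs \<le> average n (\<lambda>i. average m (f i)) y) \<and>
       quantization_operator d \<omega> Q \<and>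
       \<alpha> = 1 / (\<omega> + 1) \<and>
       \<gamma> = 1 / (L * (1 + 36 * (\<omega> + 1) / real n)) \<and>
       x0 \<in> Rd d \<and> h0 \<in> {..<n} \<rightarrow>\<^sub>E Rd d \<and> w0 \<in> {..<n} \<rightarrow>\<^sub>E ({..<m} \<rightarrow>\<^sub>E Rd d) \<and>
       b = 4 * (\<omega> + 1) / (\<alpha> * (real n)\<^sup>2) \<and>
       c = 16 * (\<omega> + 1) / (real n)\<^sup>2 \<and>
       \<psi>0 = lyapunov d n m f b c \<gamma> xs (x0, h0, w0)
       \<longrightarrow>
       (\<forall>(\<epsilon>::real) (k::nat).
          0 < \<epsilon> \<and> \<epsilon> < 1 \<and>
          real k \<ge> C * (\<kappa> + \<kappa> * (\<omega> / real n) + real m + \<omega>) * ln (1 / \<epsilon>) \<longrightarrow>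
          integrable (vr_diana v d n m f Q \<alpha> \<gamma> (x0, h0, w0) k)
            (\<lambda>s. (norm2 d (fst s - xs))\<^sup>2) \<and>
          (\<integral>s. (norm2 d (fst s - xs))\<^sup>2 \<partial>vr_diana v d n m f Q \<alpha> \<gamma> (x0, h0, w0) k)
            \<le> \<epsilon> * \<psi>0))"
proof (intro exI[of _ "37 :: real"] conjI[OF zero_less_numeral] allI impI, elim conjE)
  fix v :: variant and d n m :: nat and f :: "nat \<Rightarrow> nat \<Rightarrow> vec \<Rightarrow> real"
    and L \<mu> \<kappa> \<omega> :: real and Q :: "vec \<Rightarrow> vec measure" and \<alpha> \<gamma> b c :: real and xs x0 :: vec
    and h0 :: "nat \<Rightarrow> vec" and w0 :: "nat \<Rightarrow> nat \<Rightarrow> vec" and \<psi>0 \<epsilon> :: real and k :: nat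
  assume nm: "n \<ge> 1" "m \<ge> 1"
    and f: "\<forall>i<n. \<forall>j<m. convex_Rd d (f i j) \<and> L_smooth d L (f i j)"
    and \<mu>: "\<mu> > 0" "\<forall>i<n. strongly_convex d \<mu> (average m (f i))"
    and \<kappa>: "\<kappa> = L / \<mu>"
    and xs: "xs \<in> Rd d" "\<forall>y\<in>Rd d. average n (\<lambda>i. average m (f i)) xs \<le> average n (\<lambda>i. average m (f i)) y"
    and Q: "quantization_operator d \<omega> Q"
    and al: "\<alpha> = 1 / (\<omega> + 1)" and ga: "\<gamma> = 1 / (L * (1 + 36 * (\<omega> + 1) / real n))"
    and s0: "x0 \<in> Rd d" "h0 \<in> {..<n} \<rightarrow>\<^sub>E Rd d" "w0 \<in> {..<n} \<rightarrow>\<^sub>E ({..<m} \<rightarrow>\<^sub>E Rd d)"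
    and b: "b = 4 * (\<omega> + 1) / (\<alpha> * (real n)\<^sup>2)" and c: "c = 16 * (\<omega> + 1) / (real n)\<^sup>2"
    and psi: "\<psi>0 = lyapunov d n m f b c \<gamma> xs (x0, h0, w0)"
    and \<epsilon>: "0 < \<epsilon>" "\<epsilon> < 1"
    and k: "37 * (\<kappa> + \<kappa> * (\<omega> / real n) + real m + \<omega>) * ln (1 / \<epsilon>) \<le> real k"
  interpret finite_sum_problem d n m f L \<mu> xs
    using nm f \<mu> xs by unfold_locales auto
  define D where "D = L / \<mu> + L / \<mu> * (\<omega> / real n) + real m + \<omega>"
  define \<rho> where "\<rho> = 1 / (37 * D)"
  have om: "\<omega> \<ge> 0" using Q by (simp add: quantization_operator_def)
  have D: "D \<ge> 1" and rho: "\<rho> \<le> \<gamma> * \<mu>" "\<rho> \<le> \<alpha> / 2" "\<rho> \<le> 3 / (8 * real m)"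
    using rate_le[OF nm L_pos \<mu>(1) om] by (simp_all add: \<rho>_def D_def al ga)
  have s0': "(x0, h0, w0) \<in> space (state_space d n m)" using s0 by (simp add: space_state_space)
  have bc: "b \<ge> 0" "c \<ge> 0" using om by (auto simp: b c al)
  have "(1 - \<rho>) ^ k \<le> \<epsilon>"
  proof (rule geometric_decay)
    show "0 < \<rho>" "\<rho> \<le> 1" using D by (auto simp: \<rho>_def)
    show "1 / \<rho> * ln (1 / \<epsilon>) \<le> real k" using k by (simp add: \<rho>_def D_def \<kappa>)
  qed (rule \<epsilon>(1))
  then have "(1 - \<rho>) ^ k * \<psi>0 \<le> \<epsilon> * \<psi>0"
    unfolding psi by (intro mult_right_mono lyapunov_nonneg bc)
  with iterate_error_le[OF Q al ga b c rho s0', of v k]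
  show "integrable (vr_diana v d n m f Q \<alpha> \<gamma> (x0, h0, w0) k) (\<lambda>s. (norm2 d (fst s - xs))\<^sup>2) \<and>
    (\<integral>s. (norm2 d (fst s - xs))\<^sup>2 \<partial>vr_diana v d n m f Q \<alpha> \<gamma> (x0, h0, w0) k) \<le> \<epsilon> * \<psi>0"
    unfolding psi by auto
qed

end
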